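(* Assume that the nonlinear matrix pencil $\iota(\lambda)$ is meromorphic in $\{|\lambda|<M\}$ and possesses a unique smallest spectral value $\lambda_0$ with $|\lambda_0|<M$, that is, $\iota(\lambda)^{-1}$ is analytic in $\{|\lambda|<M,\ \lambda\neq\lambda_0\}$. Then, for any $K\ge1$, the associated inverse power iteration $$\underline{u}_{k+1}=\mathcal{A}\underline{u}_k,$$ with compactly supported initial data, $(\underline{u}_0)_j=0$ for all $j>K$, converges for all initial vectors $((\underline{u}_0)_j)_{1\le j\le K}\in(\mathbb{C}^N)^K$ except for a finite-codimension subspace, locally uniformly. More precisely, for any $K_0$, the restriction to the first $K_0$ components, $R_{K_0}\underline{u}=(u_1,\dots,u_{K_0})$, converges to the restriction of a formal eigenvector $\underline{u}_*$, $$R_{K_0}\underline{u}_k/|R_{K_0}\underline{u}_k|\to R_{K_0}\underline{u}_*,$$ and $$R_{K_0}\left(\mathcal{A}\underline{u}_k-\lambda_0^{-1}\underline{u}_k\right)\to0\quad\text{for }k\to\infty.$$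
   Context: The pencil $\iota(\lambda)\in\mathbb{C}^{N\times N}$ has a power series $\iota(\lambda)=\sum_{k\ge0}\iota_k\lambda^k$ with positive radius of convergence at $\lambda=0$, $\iota_0$ is invertible, and $\iota$ also denotes its meromorphic continuation to $\{|\lambda|<M\}$. The radius of convergence of the power series may be smaller than $|\lambda_0|$. A point $\lambda_1$ is a spectral value of $\iota$ if $\lambda\mapsto\iota(\lambda)^{-1}$ is not analytic at $\lambda_1$. The map $\mathcal{A}$ acts on compactly supported sequences $\underline{u}=(u_j)_{j\ge1}$, $u_j\in\mathbb{C}^N$, by $(\mathcal{A}\underline{u})_1=-\iota_0^{-1}\sum_{k\ge1}\iota_ku_k$ and $(\mathcal{A}\underline{u})_j=u_{j-1}$ for $j>1$. Formal eigenvector: solving $\mathcal{A}\underline{u}=z\underline{u}$ formally with $z=\lambda_0^{-1}$, the components $j>1$ give $u_j=\lambda_0^{j}u_0$ for a vector $u_0\in\mathbb{C}^N$, and the first component formally becomes $\iota(\lambda_0)u_0=0$. The infinite sum in the first component need not converge when $|\lambda_0|$ exceeds the radius of convergence, which is why the eigenvector is only formal.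
   Formalization: The first limit holds after multiplying by the phase (λ₀/|λ₀|)^k, with limit R u_*/|R u_*|; the second holds for the normalised iterates u_k/|R u_k|; both fail as displayed. If ι has a pole at λ₀, ι(λ₀)u₀=0 is read via root functions. *)

theory Defs
  imports "HOL-Complex_Analysis.Complex_Analysis" "HOL-Library.Function_Algebras"
begin

text \<open>A sequence indexed by \<open>j \<ge> 1\<close> is a function on \<open>nat\<close> whose value at the unused index \<open>0\<close> is
  \<open>0\<close>; addition of sequences is pointwise, from \<open>Function_Algebras\<close>.\<close>

type_synonym 'n cseq = "nat \<Rightarrow> complex ^ 'n"

definition seq_scale :: "complex \<Rightarrow> 'n::finite cseq \<Rightarrow> 'n cseq" where
  "seq_scale c u = (\<lambda>j. c *s u j)"

global_interpretation cseq: vector_space "seq_scale :: complex \<Rightarrow> 'n::finite cseq \<Rightarrow> 'n cseq"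
  by standard (auto simp: seq_scale_def vec_eq_iff algebra_simps)

definition compactly_supported :: "'n::finite cseq set" where
  "compactly_supported = {u. u 0 = 0 \<and> finite {j. u j \<noteq> 0}}"

text \<open>The copy of \<open>(\<complex>\<^sup>N)\<^sup>K\<close> inside the compactly supported sequences.\<close>

definition supported_upto :: "nat \<Rightarrow> 'n::finite cseq set" where
  "supported_upto K = {u. \<forall>j. j \<notin> {1..K} \<longrightarrow> u j = 0}"

definition finite_codim :: "'n::finite cseq set \<Rightarrow> 'n cseq set \<Rightarrow> bool" where
  "finite_codim E V \<longleftrightarrow> (\<exists>B. finite B \<and> V \<subseteq> cseq.span (E \<union> B))"

text \<open>\<open>restr_norm K u\<close> is the Euclidean norm of the restriction of \<open>u\<close> to its first \<open>K\<close> components,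
  and \<open>normalized K u\<close> is the whole sequence \<open>u\<close> divided by that number. A power
  iteration converges in direction only: for the spectral
  value \<open>z\<^sub>0\<close> iterates grow like \<open>z\<^sub>0\<^sup>-\<^sup>k\<close>, whose modulus \<open>normalized\<close> removes
  and whose phase is removed by the factor \<open>sgn z\<^sub>0 ^ k = (z\<^sub>0 / \<bar>z\<^sub>0\<bar>) ^ k\<close>, which is \<open>1\<close> for
  \<open>z\<^sub>0 > 0\<close>.\<close>

definition restr_norm :: "nat \<Rightarrow> 'n::finite cseq \<Rightarrow> real" where
  "restr_norm K u = L2_set (\<lambda>j. norm (u j)) {1..K}"

definition normalized :: "nat \<Rightarrow> 'n::finite cseq \<Rightarrow> 'n cseq" where
  "normalized K u = seq_scale (of_real (inverse (restr_norm K u))) u"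

text \<open>On compactly supported sequences the series in the first component is the finite sum over
  the support.\<close>

definition companion_op :: "(nat \<Rightarrow> complex ^ 'n ^ 'n) \<Rightarrow> 'n::finite cseq \<Rightarrow> 'n cseq" where
  "companion_op a u = (\<lambda>j.
     if j = 0 then 0
     else if j = 1 then - (matrix_inv (a 0) *v (\<Sum>k | k \<ge> 1 \<and> u k \<noteq> 0. a k *v u k))
     else u (j - 1))"

text \<open>As a meromorphic function, \<open>\<iota>(\<lambda>)\<^sup>-\<^sup>1\<close> is considered up to removable singularities. This matters
  at poles of \<open>\<iota>\<close>, where the value of the Isabelle function carries no information but the inverse
  may extend analytically.\<close>

definition inverse_analytic_at :: "(complex \<Rightarrow> complex ^ 'n ^ 'n) \<Rightarrow> complex \<Rightarrow> bool" where
  "inverse_analytic_at \<iota> z \<longleftrightarrow>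
     (\<exists>g :: complex \<Rightarrow> complex ^ 'n ^ 'n. (\<forall>i j. (\<lambda>w. g w $ i $ j) analytic_on {z}) \<and>
          (\<forall>\<^sub>F w in at z. invertible (\<iota> w) \<and> g w = matrix_inv (\<iota> w)))"

definition spectral_value :: "(complex \<Rightarrow> complex ^ 'n ^ 'n) \<Rightarrow> complex \<Rightarrow> bool" where
  "spectral_value \<iota> z \<longleftrightarrow> \<not> inverse_analytic_at \<iota> z"

text \<open>The equation \<open>\<iota>(z) v = 0\<close>. The pencil may have a pole at \<open>z\<close>; then the equation is understood
  in the usual sense of root functions: some analytic vector function \<open>f\<close> with \<open>f(z) = v\<close> satisfies
  \<open>\<iota>(\<lambda>) f(\<lambda>) \<rightarrow> 0\<close> as \<open>\<lambda> \<rightarrow> z\<close>. The lemma after the definition shows that where \<open>\<iota>\<close> is analytic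
  the second reading coincides with the first.\<close>

definition root_vector :: "(complex \<Rightarrow> complex ^ 'n ^ 'n) \<Rightarrow> complex \<Rightarrow> complex ^ 'n \<Rightarrow> bool" where
  "root_vector \<iota> z v \<longleftrightarrow>
     (\<exists>f :: complex \<Rightarrow> complex ^ 'n. (\<forall>i. (\<lambda>w. f w $ i) analytic_on {z}) \<and> f z = v \<and>
          ((\<lambda>w. \<iota> w *v f w) \<longlongrightarrow> 0) (at z))"

definition in_kernel_at :: "(complex \<Rightarrow> complex ^ 'n ^ 'n) \<Rightarrow> complex \<Rightarrow> complex ^ 'n \<Rightarrow> bool" where
  "in_kernel_at \<iota> z v \<longleftrightarrow>
     (if \<forall>i j. (\<lambda>w. \<iota> w $ i $ j) analytic_on {z} then \<iota> z *v v = 0 else root_vector \<iota> z v)"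

lemma root_vector_iff_if_analytic:
  fixes \<iota> :: "complex \<Rightarrow> complex ^ 'n ^ 'n"
  assumes "\<forall>i j. (\<lambda>w. \<iota> w $ i $ j) analytic_on {z}"
  shows "root_vector \<iota> z v \<longleftrightarrow> \<iota> z *v v = 0"
proof -
  have lim: "((\<lambda>w. \<iota> w *v f w) \<longlongrightarrow> \<iota> z *v f z) (at z)"
    if f: "\<forall>i. (\<lambda>w. f w $ i) analytic_on {z}" for f :: "complex \<Rightarrow> complex ^ 'n"
  proof (rule vec_tendstoI)
    fix i
    have *: "isCont (\<lambda>w. \<iota> w $ i $ j) z" "isCont (\<lambda>w. f w $ j) z" for j
      using assms f analytic_at_imp_isCont by blast+
    show "((\<lambda>w. (\<iota> w *v f w) $ i) \<longlongrightarrow> (\<iota> z *v f z) $ i) (at z)"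
      unfolding matrix_vector_mult_def vec_lambda_beta
      by (intro tendsto_sum tendsto_mult) (use * in \<open>auto simp: isCont_def\<close>)
  qed
  show ?thesis
  proof
    assume "root_vector \<iota> z v"
    then obtain f :: "complex \<Rightarrow> complex ^ 'n" where f:
      "\<forall>i. (\<lambda>w. f w $ i) analytic_on {z}" "f z = v"
      "((\<lambda>w. \<iota> w *v f w) \<longlongrightarrow> 0) (at z)"
      unfolding root_vector_def by blast
    show "\<iota> z *v v = 0"
      using tendsto_unique[OF _ lim[OF f(1)] f(3)] f(2) by simp
  next
    assume "\<iota> z *v v = 0"
    then show "root_vector \<iota> z v"
      unfolding root_vector_def using lim[of "\<lambda>_. v"] by (intro exI[of _ "\<lambda>_. v"]) auto
  qed
qed

definition formal_eigenvector ::
    "(complex \<Rightarrow> complex ^ 'n ^ 'n) \<Rightarrow> complex \<Rightarrow> 'n::finite cseq \<Rightarrow> bool" where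
  "formal_eigenvector \<iota> z u \<longleftrightarrow>
     (\<exists>v. v \<noteq> 0 \<and> in_kernel_at \<iota> z v \<and> u 0 = 0 \<and> (\<forall>j\<ge>1. u j = z ^ j *s v))"

definition locally_uniformly_null ::
    "nat \<Rightarrow> 'n::finite cseq set \<Rightarrow> (nat \<Rightarrow> 'n cseq \<Rightarrow> real) \<Rightarrow> bool" where
  "locally_uniformly_null K S f \<longleftrightarrow>
     (\<forall>u\<in>S. \<exists>\<delta>>0. uniform_limit {u' \<in> S. restr_norm K (u' - u) < \<delta>} f (\<lambda>_. 0) sequentially)"

end

theory Submission
  imports Defs
begin

text \<open>Write \<open>A\<close> for the companion operator and let \<open>u\<close> be supported in \<open>1..K\<close>. Since \<open>A\<close> shifts
  every component but the first, the sequence \<open>w\<^sub>m = (A\<^sup>m u)\<^sub>K\<close> contains all non-zero components of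
  all iterates, and the equation for the first component becomes \<open>\<Sum>\<^sub>k a\<^sub>k w\<^sub>m\<^sub>-\<^sub>k = 0\<close> for \<open>m \<ge> K\<close>. In terms
  of formal power series this says \<open>\<iota>(\<lambda>) W(\<lambda>) = P(\<lambda>)\<close> with \<open>W = \<Sum> w\<^sub>m \<lambda>\<^sup>m\<close> and a polynomial \<open>P\<close> of
  degree less than \<open>K\<close> (\<open>pencil_times_iterates_fps\<close>). So \<open>W\<close> is the expansion at \<open>0\<close> of
  \<open>\<iota>\<^sup>-\<^sup>1 P\<close>, which is holomorphic in \<open>\<bar>\<lambda>\<bar> < M\<close> except at \<open>z\<^sub>0\<close>.

  By Cramer's rule \<open>\<iota>\<^sup>-\<^sup>1\<close> is meromorphic at \<open>z\<^sub>0\<close>, so it has a pole there, of some order \<open>d \<ge> 1\<close>, and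
  \<open>\<Phi>(\<lambda>) = (\<lambda> - z\<^sub>0)\<^sup>d \<iota>(\<lambda>)\<^sup>-\<^sup>1\<close> is holomorphic in \<open>\<bar>\<lambda>\<bar> < M\<close> with \<open>\<Phi>(z\<^sub>0) \<noteq> 0\<close>
  (\<open>resolvent_times_power_holomorphic\<close>). The coefficients of \<open>\<Phi> P / (\<lambda> - z\<^sub>0)\<^sup>d\<close> are dominated by
  the pole: with weights \<open>z\<^sub>0\<^sup>m\<close> divided by the binomial coefficient \<open>m + d - 1\<close> over \<open>m\<close>, they
  converge to \<open>(-z\<^sub>0)\<^sup>-\<^sup>d \<Phi>(z\<^sub>0) P(z\<^sub>0)\<close> (\<open>fps_coeff_asymptotics_at_pole\<close>). Shifting indices, the
  weighted iterates converge componentwise to \<open>(z\<^sub>0\<^sup>j L u)\<^sub>j\<close>, where \<open>L\<close> is linear in \<open>u\<close> and \<open>L u\<close> is a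
  multiple of \<open>\<Phi>(z\<^sub>0) P(z\<^sub>0)\<close>. This vector is a root vector of \<open>\<iota>\<close> because
  \<open>\<iota>(\<lambda>) \<Phi>(\<lambda>) P(\<lambda>) = (\<lambda> - z\<^sub>0)\<^sup>d P(\<lambda>)\<close> tends to \<open>0\<close> at \<open>z\<^sub>0\<close>.

  The exceptional subspace is the kernel of \<open>L\<close>. It has finite codimension since \<open>L\<close> takes values in
  \<open>\<complex>\<^sup>N\<close>, and it contains none of the spaces \<open>(\<complex>\<^sup>N)\<^sup>K\<close>: if only \<open>u\<^sub>1\<close>
  is non-zero, one can take \<open>K = 1\<close>, and \<open>P\<close> is the constant \<open>a\<^sub>0 u\<^sub>1\<close>, an arbitrary vector. On the complement, the weight of index \<open>k\<close> has the phase \<open>(z\<^sub>0 / \<bar>z\<^sub>0\<bar>)\<^sup>k\<close>,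
  so normalising the weighted iterates is normalising \<open>A\<^sup>k u\<close> and correcting its phase; and
  consecutive weights have quotients tending to \<open>z\<^sub>0\<close>, which gives the eigenvalue equation in the
  limit. The convergence is locally uniform because on the finite-dimensional space \<open>(\<complex>\<^sup>N)\<^sup>K\<close> a
  pointwise null sequence of linear maps is null in operator norm (\<open>seq_linear_bound\<close>).\<close>

(* The sign $ is kept for components of vectors; it also denotes coefficients of power series. *)
no_notation fps_nth (infixl "$" 75)

section \<open>Power series coefficients in the presence of one pole\<close>

text \<open>The binomial coefficient is the coefficient of \<open>x\<^sup>k\<close> in \<open>1 / (1 - x)\<^sup>e\<^sup>+\<^sup>1\<close>, so the weight is the
  inverse of the \<open>k\<close>-th coefficient of \<open>1 / (1 - \<lambda> / z\<^sub>0)\<^sup>e\<^sup>+\<^sup>1\<close>: a pole of order \<open>e + 1\<close> at \<open>z\<^sub>0\<close>.\<close>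

definition pole_weight :: "complex \<Rightarrow> nat \<Rightarrow> nat \<Rightarrow> complex" where
  "pole_weight z\<^sub>0 e k = z\<^sub>0 ^ k / of_nat ((e + k) choose k)"

lemma binomial_shift_pos: "(e + k) choose k > 0"
  by simp

lemma binomial_ratio_Suc:
  "(\<lambda>k. of_nat ((e + k) choose k) / of_nat ((e + Suc k) choose Suc k) :: complex) \<longlonglongrightarrow> 1"
proof -
  have "of_nat ((e + k) choose k) / of_nat ((e + Suc k) choose Suc k) =
        (of_real (real (Suc k) / real (Suc k + e)) :: complex)" for k
  proof -
    have "Suc k * ((e + Suc k) choose Suc k) = (Suc k + e) * ((e + k) choose k)"
      using Suc_times_binomial[of k "e + k"] by (simp add: add.commute)
    then have "(of_nat (Suc k) * of_nat ((e + Suc k) choose Suc k) :: complex) =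
        of_nat (Suc k + e) * of_nat ((e + k) choose k)"
      by (metis of_nat_mult)
    moreover have "(of_nat ((e + Suc k) choose Suc k) :: complex) \<noteq> 0"
      using binomial_shift_pos[of e "Suc k"] by (metis of_nat_eq_0_iff less_irrefl)
    moreover have "(of_nat (Suc k + e) :: complex) \<noteq> 0"
      using of_nat_eq_0_iff by (metis add_is_0 nat.distinct(2))
    ultimately show ?thesis by (simp add: field_simps del: of_nat_Suc of_nat_add binomial_Suc_Suc)
  qed
  moreover have "(\<lambda>k. real (Suc k) / real (Suc k + e)) \<longlonglongrightarrow> 1"
  proof -
    have "(\<lambda>k. real (Suc k) / real (Suc k + e)) = (\<lambda>k. 1 - real e / real (k + Suc e))"
      by (auto simp: fun_eq_iff field_simps)
    moreover have "(\<lambda>k. real e / real (k + Suc e)) \<longlonglongrightarrow> 0"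
      using LIMSEQ_ignore_initial_segment[OF lim_const_over_n[of "real e"], of "Suc e"] by simp
    ultimately show ?thesis using tendsto_diff[OF tendsto_const] by fastforce
  qed
  ultimately show ?thesis
    using tendsto_of_real[of "\<lambda>k. real (Suc k) / real (Suc k + e)" 1 sequentially,
        where ?'a = complex]
    by (simp only: of_real_1)
qed

lemma binomial_ratio_shift:
  "(\<lambda>m. of_nat ((e + m) choose m) / of_nat ((e + (m + l)) choose (m + l)) :: complex) \<longlonglongrightarrow> 1"
proof (induction l)
  case 0
  have "(of_nat ((e + m) choose m) / of_nat ((e + m) choose m) :: complex) = 1" for m
    using binomial_shift_pos[of e m] by (simp del: zero_less_binomial_iff)
  then show ?case by simp
next
  case (Suc l)
  have "(\<lambda>m. (of_nat ((e + m) choose m) / of_nat ((e + (m + l)) choose (m + l)))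
     * (of_nat ((e + (m + l)) choose (m + l)) / of_nat ((e + Suc (m + l)) choose Suc (m + l))) :: complex)
      \<longlonglongrightarrow> 1 * 1"
    by (intro tendsto_mult Suc.IH LIMSEQ_ignore_initial_segment[OF binomial_ratio_Suc])
  moreover have "(of_nat ((e + (m + l)) choose (m + l)) :: complex) \<noteq> 0" for m
    using binomial_shift_pos[of e "m+l"] by (metis of_nat_eq_0_iff less_irrefl)
  ultimately show ?case by (simp del: binomial_Suc_Suc)
qed

lemma pole_weight_ratio:
  assumes "z\<^sub>0 \<noteq> 0"
  shows "(\<lambda>k. pole_weight z\<^sub>0 e (Suc k) / pole_weight z\<^sub>0 e k) \<longlonglongrightarrow> z\<^sub>0"
proof -
  have "(\<lambda>k. z\<^sub>0 * (of_nat ((e + k) choose k) / of_nat ((e + Suc k) choose Suc k))) \<longlonglongrightarrow> z\<^sub>0 * 1"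
    by (intro tendsto_intros binomial_ratio_Suc)
  moreover have "z\<^sub>0 * (of_nat ((e + k) choose k) / of_nat ((e + Suc k) choose Suc k))
      = pole_weight z\<^sub>0 e (Suc k) / pole_weight z\<^sub>0 e k" for k
    using assms by (simp add: pole_weight_def del: binomial_Suc_Suc)
  ultimately show ?thesis by simp
qed

text \<open>Dividing by \<open>(\<lambda> - z\<^sub>0)\<^sup>e\<^sup>+\<^sup>1\<close> convolves the coefficients of \<open>h\<close> with inverse weights. After scaling, the
  \<open>l\<close>-th term of the convolution is \<open>h\<^sub>l z\<^sub>0\<^sup>l\<close> times a quotient of binomial coefficients that is at most \<open>1\<close> and
  tends to \<open>1\<close>. Since \<open>z\<^sub>0\<close> lies inside the disc where \<open>h\<close> is holomorphic, Tannery's theorem applies.\<close>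

lemma fps_coeff_asymptotics_at_pole:
  assumes h: "h holomorphic_on ball 0 M" and z0: "z\<^sub>0 \<noteq> 0" "norm z\<^sub>0 < M"
    and c: "(fps_X - fps_const z\<^sub>0) ^ Suc e * c = fps_expansion h 0"
  shows "(\<lambda>m. pole_weight z\<^sub>0 e m * fps_nth c m) \<longlonglongrightarrow> h z\<^sub>0 / (- z\<^sub>0) ^ Suc e"
proof -
  define b :: "nat \<Rightarrow> complex" where "b k = of_nat ((e + k) choose k)" for k
  define H where "H = fps_expansion h 0"
  have b0: "b k \<noteq> 0" for k
    unfolding b_def using binomial_shift_pos[of e k] by (metis of_nat_eq_0_iff less_irrefl)
  have M: "0 < M" using z0 by (metis norm_ge_zero le_less_trans)
  have "h has_fps_expansion H"
    unfolding H_def by (intro has_fps_expansion_fps_expansion[of "ball 0 M"]) (use h M in auto)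
  have radius: "fps_conv_radius H \<ge> ereal M"
    by (rule holomorphic_on_imp_fps_conv_radius_ge[OF \<open>h has_fps_expansion H\<close>]) (use h in simp)
  have eval: "(\<lambda>l. fps_nth H l * z\<^sub>0 ^ l) sums h z\<^sub>0"
    by (rule has_fps_expansion_imp_sums_complex[of _ _ "ereal M"])
       (use h z0 \<open>h has_fps_expansion H\<close> in auto)
  have "ereal (norm z\<^sub>0) < conv_radius (fps_nth H)"
    using radius z0(2) unfolding fps_conv_radius_def by (metis less_ereal.simps(1) less_le_trans)
  then have summ: "summable (\<lambda>l. norm (fps_nth H l * z\<^sub>0 ^ l))"
    by (rule abs_summable_in_conv_radius)
  have coeff: "(- z\<^sub>0) ^ Suc e * (pole_weight z\<^sub>0 e m * fps_nth c m) =
      (\<Sum>l\<le>m. fps_nth H l * z\<^sub>0 ^ l * (b (m - l) / b m))" for m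
  proof -
    define G where "G = (1 - fps_const (inverse z\<^sub>0) * fps_X) ^ Suc e"
    have G: "inverse G = Abs_fps (\<lambda>k. b k * inverse z\<^sub>0 ^ k)"
      unfolding G_def b_def by (subst one_minus_const_fps_X_neg_power') (auto simp: fps_eq_iff)
    have G1: "inverse G * G = 1" by (rule inverse_mult_eq_1) (simp add: G_def fps_power_zeroth)
    have "fps_X - fps_const z\<^sub>0 = fps_const (- z\<^sub>0) * (1 - fps_const (inverse z\<^sub>0) * fps_X)"
      using z0 by (auto simp: fps_eq_iff algebra_simps fps_X_def)
    then have "(fps_X - fps_const z\<^sub>0) ^ Suc e = fps_const ((- z\<^sub>0) ^ Suc e) * G"
      unfolding G_def by (simp only: power_mult_distrib fps_const_power)
    then have "fps_const ((- z\<^sub>0) ^ Suc e) * G * c = H" using c unfolding H_def by simp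
    then have "fps_const ((- z\<^sub>0) ^ Suc e) * c = H * inverse G"
      using G1 by (metis (no_types, opaque_lifting) mult.assoc mult.commute mult_1)
    then have "(- z\<^sub>0) ^ Suc e * fps_nth c m = fps_nth (H * inverse G) m"
      by (metis fps_mult_left_const_nth)
    also have "\<dots> = (\<Sum>l\<le>m. fps_nth H l * (b (m - l) * inverse z\<^sub>0 ^ (m - l)))"
      by (simp add: fps_mult_nth G atMost_atLeast0)
    finally have "(- z\<^sub>0) ^ Suc e * fps_nth c m =
      (\<Sum>l\<le>m. fps_nth H l * (b (m - l) * inverse z\<^sub>0 ^ (m - l)))" .
    then have "(- z\<^sub>0) ^ Suc e * (pole_weight z\<^sub>0 e m * fps_nth c m) =
      pole_weight z\<^sub>0 e m * (\<Sum>l\<le>m. fps_nth H l * (b (m - l) * inverse z\<^sub>0 ^ (m - l)))"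
      by (simp only: mult.left_commute[of _ "pole_weight z\<^sub>0 e m"])
    also have "\<dots> = (\<Sum>l\<le>m. fps_nth H l * z\<^sub>0 ^ l * (b (m - l) / b m))"
      unfolding sum_distrib_left
    proof (rule sum.cong)
      fix l assume "l \<in> {..m}"
      then have "z\<^sub>0 ^ m = z\<^sub>0 ^ l * z\<^sub>0 ^ (m - l)" by (simp flip: power_add)
      then show "pole_weight z\<^sub>0 e m * (fps_nth H l * (b (m - l) * inverse z\<^sub>0 ^ (m - l))) =
         fps_nth H l * z\<^sub>0 ^ l * (b (m - l) / b m)"
        using z0 by (simp add: pole_weight_def b_def[symmetric] power_inverse field_simps)
    qed simp
    finally show ?thesis .
  qed
  have blim: "(\<lambda>m. b (m - l) / b m) \<longlonglongrightarrow> 1" for l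
    by (rule LIMSEQ_offset[where k = l]) (use binomial_ratio_shift[of e l] in \<open>simp add: b_def\<close>)
  have bmono: "norm (b (m - l) / b m) \<le> 1" for m l
  proof -
    have "(e + k) choose k \<le> (e + Suc k) choose Suc k" for k by simp
    then have "(e + (m - l)) choose (m - l) \<le> (e + m) choose m"
      by (rule lift_Suc_mono_le[of "\<lambda>k. (e + k) choose k"]) simp
    then show ?thesis by (auto simp: b_def norm_divide divide_le_eq)
  qed
  define t where "t l m = (if l \<le> m then fps_nth H l * z\<^sub>0 ^ l * (b (m - l) / b m) else 0)" for l m
  have "(\<lambda>m. \<Sum>l. t l m) \<longlonglongrightarrow> (\<Sum>l. fps_nth H l * z\<^sub>0 ^ l)"
  proof (rule tannerys_theorem[THEN conjunct2, THEN conjunct2])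
    fix l
    have "(\<lambda>m. fps_nth H l * z\<^sub>0 ^ l * (b (m - l) / b m)) \<longlonglongrightarrow> fps_nth H l * z\<^sub>0 ^ l * 1"
      by (intro tendsto_intros blim)
    moreover have "\<forall>\<^sub>F m in sequentially. fps_nth H l * z\<^sub>0 ^ l * (b (m - l) / b m) = t l m"
      using eventually_ge_at_top[of l] by eventually_elim (simp add: t_def)
    ultimately show "(\<lambda>m. t l m) \<longlonglongrightarrow> fps_nth H l * z\<^sub>0 ^ l"
      using Lim_transform_eventually by fastforce
  next
    have "norm (t l m) \<le> norm (fps_nth H l * z\<^sub>0 ^ l)" for l m
    proof (cases "l \<le> m")
      case True
      have "norm (t l m) = norm (fps_nth H l * z\<^sub>0 ^ l) * norm (b (m - l) / b m)"
        using True by (simp only: t_def if_True norm_mult)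
      then show ?thesis using bmono by (simp only: mult_left_le norm_ge_zero)
    qed (simp add: t_def)
    then show "\<forall>\<^sub>F (l, m) in sequentially \<times>\<^sub>F sequentially. norm (t l m) \<le> norm (fps_nth H l * z\<^sub>0 ^ l)"
      by (intro always_eventually) auto
  qed (use summ in auto)
  moreover have "(\<Sum>l. t l m) = (- z\<^sub>0) ^ Suc e * (pole_weight z\<^sub>0 e m * fps_nth c m)" for m
    unfolding coeff by (subst suminf_finite[of "{..m}"]) (auto simp: t_def)
  ultimately have "(\<lambda>m. (- z\<^sub>0) ^ Suc e * (pole_weight z\<^sub>0 e m * fps_nth c m)) \<longlonglongrightarrow> h z\<^sub>0"
    using eval by (simp add: sums_iff)
  then have "(\<lambda>m. (- z\<^sub>0) ^ Suc e * (pole_weight z\<^sub>0 e m * fps_nth c m) / (- z\<^sub>0) ^ Suc e)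
      \<longlonglongrightarrow> h z\<^sub>0 / (- z\<^sub>0) ^ Suc e"
    by (intro tendsto_divide) (use z0 in auto)
  then show ?thesis using z0 by simp
qed

lemma pole_weight_nonzero: "z\<^sub>0 \<noteq> 0 \<Longrightarrow> pole_weight z\<^sub>0 e k \<noteq> 0"
  by (simp add: pole_weight_def)

lemma sgn_pole_weight: "sgn (pole_weight z\<^sub>0 e k) = sgn z\<^sub>0 ^ k"
proof -
  have "sgn (complex_of_real (real ((e + k) choose k))) = 1"
    using binomial_shift_pos[of e k] by (subst sgn_of_real) (simp del: zero_less_binomial_iff)
  moreover have "sgn (z\<^sub>0 ^ k) = sgn z\<^sub>0 ^ k" by (induction k) (auto simp: sgn_mult)
  ultimately show ?thesis by (simp add: pole_weight_def sgn_divide)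
qed

lemma power_series_has_fps_expansion:
  fixes f :: "complex \<Rightarrow> complex"
  assumes "r > 0" "\<And>z. z \<in> ball 0 r \<Longrightarrow> (\<lambda>k. c k * z ^ k) sums f z"
  shows "f has_fps_expansion Abs_fps c"
proof (rule has_fps_expansionI)
  have "\<forall>\<^sub>F z in nhds 0. z \<in> ball 0 r" using assms(1) by (intro eventually_nhds_in_open) auto
  then show "\<forall>\<^sub>F z in nhds 0. (\<lambda>k. fps_nth (Abs_fps c) k * z ^ k) sums f z"
    by eventually_elim (use assms(2) in simp)
qed

text \<open>Identities involving \<open>\<iota>\<^sup>-\<^sup>1\<close> are available on punctured neighbourhoods only; continuity extends
  them to the centre.\<close>

lemma has_fps_expansion_unique_at:
  fixes f g :: "complex \<Rightarrow> complex"
  assumes "f has_fps_expansion F" "g has_fps_expansion G" "\<forall>\<^sub>F w in at 0. f w = g w"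
  shows "F = G"
proof -
  have "f \<midarrow>0\<rightarrow> f 0" "g \<midarrow>0\<rightarrow> g 0"
    using has_fps_expansion_imp_continuous[OF assms(1), of UNIV]
      has_fps_expansion_imp_continuous[OF assms(2), of UNIV] by (auto simp: continuous_at)
  then have "f 0 = g 0"
    using tendsto_cong[OF assms(3)] tendsto_unique[of "at (0::complex)"] by force
  then have "\<forall>\<^sub>F w in nhds 0. f w = g w"
    using assms(3) by (auto simp: eventually_nhds_conv_at)
  then have "f has_fps_expansion G" using assms(2) has_fps_expansion_cong by blast
  then show ?thesis using assms(1) fps_expansion_eqI by blast
qed

section \<open>The inverse of a meromorphic pencil\<close>

text \<open>A negative order is removed by a power of \<open>w - z\<close>. The order says nothing for functions
  that vanish near \<open>z\<close>, hence the case distinction.\<close>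

lemma meromorphic_at_times_power_analytic:
  assumes "f meromorphic_on {z}"
  shows "\<exists>n g. g analytic_on {z} \<and> (\<forall>\<^sub>F w in at z. g w = (w - z) ^ n * f w)"
proof (cases "\<exists>\<^sub>F w in at z. f w \<noteq> 0")
  case False
  then have "\<forall>\<^sub>F w in at z. 0 = (w - z) ^ 0 * f w"
    by (auto simp: frequently_def elim: eventually_mono)
  then show ?thesis by (intro exI[of _ 0] exI[of _ "\<lambda>_. 0"]) auto
next
  case True
  obtain r where r: "r > 0" "zor_poly f z holomorphic_on cball z r"
    "\<forall>w\<in>cball z r - {z}. f w = zor_poly f z w * (w - z) powi zorder f z"
    using zorder_exist[OF _ _ True] assms by (auto simp: meromorphic_at_iff)
  define g where "g w = zor_poly f z w * (w - z) ^ nat (zorder f z)" for w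
  have "zor_poly f z analytic_on {z}"
    using r by (metis analytic_at ball_subset_cball centre_in_ball holomorphic_on_subset open_ball)
  then have "g analytic_on {z}" unfolding g_def by (intro analytic_intros)
  moreover have "\<forall>\<^sub>F w in at z. w \<in> ball z r - {z}"
    using r by (intro eventually_at_in_open) auto
  then have "\<forall>\<^sub>F w in at z. g w = (w - z) ^ nat (- zorder f z) * f w"
  proof eventually_elim
    case (elim w)
    then have "(w - z) ^ nat (zorder f z) = (w - z) ^ nat (- zorder f z) * (w - z) powi zorder f z"
      by (auto simp: power_int_def field_simps)
    moreover have "f w = zor_poly f z w * (w - z) powi zorder f z" using r(3) elim by auto
    ultimately show ?case by (simp add: g_def)
  qed
  ultimately show ?thesis by blast
qed

lemma matrix_inv_inverse:
  fixes A :: "'a::semiring_1 ^ 'n ^ 'n"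
  assumes "invertible A"
  shows matrix_inv_right: "A ** matrix_inv A = mat 1" and matrix_inv_left: "matrix_inv A ** A = mat 1"
  using assms someI_ex[of "\<lambda>B. A ** B = mat 1 \<and> B ** A = mat 1"]
  unfolding invertible_def matrix_inv_def by blast+

lemma scaled_matrix_mult:
  fixes A B :: "complex ^ 'n ^ 'n"
  shows scaled_matrix_mult_left: "A ** B = mat 1 \<Longrightarrow> (\<chi> i j. c * A $ i $ j) ** B = mat c"
    and scaled_matrix_mult_right: "B ** A = mat 1 \<Longrightarrow> B ** (\<chi> i j. c * A $ i $ j) = mat c"
  by (auto simp: vec_eq_iff matrix_matrix_mult_def mat_def mult.assoc mult.left_commute[of _ c]
      simp flip: sum_distrib_left)

lemma matrix_inv_entry_cramer:
  fixes A :: "'a::field ^ 'n ^ 'n"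
  assumes "det A \<noteq> 0"
  shows "matrix_inv A $ i $ j = det (\<chi> k l. if l = i then axis j 1 $ k else A $ k $ l) / det A"
proof -
  have "invertible A" using assms invertible_det_nz by blast
  then have "A *v (matrix_inv A *v axis j 1) = axis j 1"
    by (simp add: matrix_vector_mul_assoc matrix_inv_right)
  then have "matrix_inv A *v axis j 1 =
      (\<chi> k. det (\<chi> i l. if l = k then axis j 1 $ i else A $ i $ l) / det A)"
    using cramer[OF assms] by blast
  then have "(matrix_inv A *v axis j 1) $ i = det (\<chi> k l. if l = i then axis j 1 $ k else A $ k $ l) / det A"
    by simp
  moreover have "(matrix_inv A *v axis j 1) $ i = matrix_inv A $ i $ j"
    by (simp add: matrix_vector_mult_def axis_def if_distrib cong: if_cong)
  ultimately show ?thesis by simp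
qed

lemma meromorphic_on_det:
  fixes A :: "complex \<Rightarrow> complex ^ 'n ^ 'n"
  assumes "\<And>i j. (\<lambda>z. A z $ i $ j) meromorphic_on S"
  shows "(\<lambda>z. det (A z)) meromorphic_on S"
  unfolding det_def by (intro meromorphic_intros assms)

lemma meromorphic_eventually_nonzero_or_zero:
  assumes "f meromorphic_on {z}"
  shows "(\<forall>\<^sub>F w in at z. f w \<noteq> 0) \<or> (\<forall>\<^sub>F w in at z. f w = 0)"
  using assms not_essential_frequently_0_imp_eventually_0[of f z]
  by (auto simp: meromorphic_at_iff frequently_def)

lemma eventually_at_eventually_at:
  fixes z :: complex
  assumes "\<forall>\<^sub>F w in at z. P w"
  shows "\<forall>\<^sub>F w in at z. \<forall>\<^sub>F v in at w. P v"
proof -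
  obtain S where S: "open S" "z \<in> S" "\<And>w. w \<in> S - {z} \<Longrightarrow> P w"
    using assms unfolding eventually_at_topological by auto
  have "\<forall>\<^sub>F w in at z. w \<in> S - {z}" using S by (intro eventually_at_in_open) auto
  then show ?thesis
  proof eventually_elim
    case (elim w)
    have "\<forall>\<^sub>F v in at w. v \<in> S - {z} - {w}"
      using S(1) elim by (intro eventually_at_in_open) auto
    then show ?case by eventually_elim (use S(3) in auto)
  qed
qed

text \<open>The determinant is meromorphic, so near \<open>z\<close> it is either non-zero or identically zero. The latter
  would make the pencil singular around nearby points \<open>w \<noteq> z\<close> too. At the spectral value itself, this is the
  way to obtain invertibility nearby from regularity at the other points.\<close>

lemma eventually_invertible_if_accumulation:
  fixes \<iota> :: "complex \<Rightarrow> complex ^ 'n ^ 'n"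
  assumes mero: "\<And>i j. (\<lambda>w. \<iota> w $ i $ j) meromorphic_on {z}"
    and other: "\<forall>\<^sub>F w in at z. \<forall>\<^sub>F v in at w. invertible (\<iota> v)"
  shows "\<forall>\<^sub>F w in at z. invertible (\<iota> w)"
proof (rule ccontr)
  assume "\<not> ?thesis"
  then have "\<not> (\<forall>\<^sub>F w in at z. det (\<iota> w) \<noteq> 0)" by (simp add: invertible_det_nz)
  then have "\<forall>\<^sub>F w in at z. det (\<iota> w) = 0"
    using meromorphic_eventually_nonzero_or_zero meromorphic_on_det[of \<iota> "{z}", OF mero] by blast
  then have "\<forall>\<^sub>F w in at z. \<forall>\<^sub>F v in at w. det (\<iota> v) = 0"
    by (rule eventually_at_eventually_at)
  then have "\<forall>\<^sub>F w in at z. False"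
    using other
  proof eventually_elim
    case (elim w)
    from elim(1,2) have "\<forall>\<^sub>F v in at w. False" by eventually_elim (simp add: invertible_det_nz)
    then show ?case by simp
  qed
  then show False by simp
qed

lemma remove_sings_of_eventually_analytic:
  assumes g: "g analytic_on {z}" and eq: "\<forall>\<^sub>F w in at z. f w = g w"
  shows "remove_sings f analytic_on {z}" and "remove_sings f z = g z"
    and "\<forall>\<^sub>F w in at z. remove_sings f w = f w"
proof -
  have lim: "f \<midarrow>z\<rightarrow> g z"
    using g eq by (metis analytic_at_imp_isCont isContD tendsto_cong)
  have iso: "isolated_singularity_at f z"
    using g eq isolated_singularity_at_analytic isolated_singularity_at_cong by blast
  show "remove_sings f analytic_on {z}" by (rule remove_sings_analytic_at[OF iso lim])
  show "remove_sings f z = g z" using lim by blast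
  show "\<forall>\<^sub>F w in at z. remove_sings f w = f w" by (rule eventually_remove_sings_eq_at[OF iso])
qed

lemma analytic_divide_out_zero:
  assumes "g analytic_on {z}" "g z = 0"
  shows "\<exists>k. k analytic_on {z} \<and> (\<forall>\<^sub>F w in at z. g w = (w - z) * k w)"
proof -
  obtain S where S: "open S" "z \<in> S" "g holomorphic_on S" using assms analytic_at by blast
  define k where "k w = (if w = z then deriv g z else (g w - g z) / (w - z))" for w
  have "k holomorphic_on S" unfolding k_def by (rule pole_lemma_open) (use S in auto)
  then have "k analytic_on {z}" using S analytic_at by blast
  moreover have "\<forall>\<^sub>F w in at z. g w = (w - z) * k w"
    unfolding eventually_at_filter using assms by (auto simp: k_def)
  ultimately show ?thesis by blast
qed

text \<open>The exponent is the least one for which multiplication by a power of \<open>w - z\<close> makes all entries of the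
  inverse analytic. It exists by Cramer's rule, it is positive because \<open>z\<close> is spectral, and the matrix of
  values at \<open>z\<close> is non-zero because otherwise one more factor \<open>w - z\<close> could be split off.\<close>

lemma resolvent_leading_term:
  fixes \<iota> :: "complex \<Rightarrow> complex ^ 'n ^ 'n"
  assumes mero: "\<And>i j. (\<lambda>w. \<iota> w $ i $ j) meromorphic_on {z}"
    and inv: "\<forall>\<^sub>F w in at z. invertible (\<iota> w)"
    and spectral: "spectral_value \<iota> z"
  shows "\<exists>e H. (\<forall>i j. H i j analytic_on {z} \<and>
      (\<forall>\<^sub>F w in at z. (w - z) ^ Suc e * matrix_inv (\<iota> w) $ i $ j = H i j w)) \<and> (\<exists>i j. H i j z \<noteq> 0)"
proof -
  define P where "P n H \<longleftrightarrow> (\<forall>i j. H i j analytic_on {z} \<and>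
      (\<forall>\<^sub>F w in at z. (w - z) ^ n * matrix_inv (\<iota> w) $ i $ j = H i j w))"
    for n and H :: "'n \<Rightarrow> 'n \<Rightarrow> complex \<Rightarrow> complex"
  have "\<forall>i j. \<exists>n g. g analytic_on {z} \<and> (\<forall>\<^sub>F w in at z. g w = (w - z) ^ n * matrix_inv (\<iota> w) $ i $ j)"
  proof (intro allI)
    fix i j
    have ax: "(\<lambda>w. (\<chi> k l. if l = i then axis j 1 $ k else \<iota> w $ k $ l) $ p $ q) meromorphic_on {z}" for p q
      using mero by (cases "q = i") (auto intro: meromorphic_intros)
    have "(\<lambda>w. det (\<chi> k l. if l = i then axis j 1 $ k else \<iota> w $ k $ l) / det (\<iota> w)) meromorphic_on {z}"
      by (rule meromorphic_on_divide[OF meromorphic_on_det[of "\<lambda>w. \<chi> k l. if l = i then axis j 1 $ k else \<iota> w $ k $ l", OF ax] meromorphic_on_det[of \<iota>, OF mero]])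
    from meromorphic_at_times_power_analytic[OF this] obtain n g where
      g: "g analytic_on {z}"
      "\<forall>\<^sub>F w in at z. g w = (w - z) ^ n * (det (\<chi> k l. if l = i then axis j 1 $ k else \<iota> w $ k $ l) / det (\<iota> w))"
      by blast
    from g(2) inv have "\<forall>\<^sub>F w in at z. g w = (w - z) ^ n * matrix_inv (\<iota> w) $ i $ j"
      by eventually_elim (auto simp: matrix_inv_entry_cramer invertible_det_nz)
    with g show "\<exists>n g. g analytic_on {z} \<and> (\<forall>\<^sub>F w in at z. g w = (w - z) ^ n * matrix_inv (\<iota> w) $ i $ j)"
      by blast
  qed
  then have "\<exists>n g. \<forall>i j. g i j analytic_on {z} \<and>
      (\<forall>\<^sub>F w in at z. g i j w = (w - z) ^ n i j * matrix_inv (\<iota> w) $ i $ j)"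
    by (simp only: choice_iff)
  then obtain n g where g: "\<And>i j. g i j analytic_on {z}"
    "\<And>i j. \<forall>\<^sub>F w in at z. g i j w = (w - z) ^ n i j * matrix_inv (\<iota> w) $ i $ j"
    by blast
  define N where "N = Max (range (\<lambda>(i, j). n i j))"
  have nN: "n i j \<le> N" for i j
    unfolding N_def by (rule Max_ge) (auto intro: rev_image_eqI[of "(i, j)"])
  have "P N (\<lambda>i j w. (w - z) ^ (N - n i j) * g i j w)"
    unfolding P_def
  proof (intro allI conjI)
    fix i j
    show "(\<lambda>w. (w - z) ^ (N - n i j) * g i j w) analytic_on {z}" using g by (intro analytic_intros)
    show "\<forall>\<^sub>F w in at z. (w - z) ^ N * matrix_inv (\<iota> w) $ i $ j = (w - z) ^ (N - n i j) * g i j w"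
      using g(2)[of i j]
    proof eventually_elim
      case (elim w)
      have "(w - z) ^ N = (w - z) ^ (N - n i j) * (w - z) ^ n i j"
        using nN by (simp flip: power_add)
      then show ?case by (simp add: elim)
    qed
  qed
  then have ex: "\<exists>n. \<exists>H. P n H" by blast
  \<comment> \<open>the order of the pole of the inverse\<close>
  define d where "d = (LEAST n. \<exists>H. P n H)"
  obtain H where H: "P d H" using LeastI_ex[OF ex] unfolding d_def by blast
  have "d \<noteq> 0"
  proof
    assume "d = 0"
    have "\<forall>\<^sub>F w in at z. \<forall>i\<in>UNIV. \<forall>j\<in>UNIV. matrix_inv (\<iota> w) $ i $ j = H i j w"
      using H \<open>d = 0\<close> by (intro eventually_ball_finite ballI) (auto simp: P_def)
    then have "\<forall>\<^sub>F w in at z. invertible (\<iota> w) \<and> (\<chi> i j. H i j w) = matrix_inv (\<iota> w)"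
      using inv by eventually_elim (auto simp: vec_eq_iff)
    then have "inverse_analytic_at \<iota> z"
      unfolding inverse_analytic_at_def using H by (intro exI[of _ "\<lambda>w. \<chi> i j. H i j w"]) (auto simp: P_def)
    then show False using spectral by (simp add: spectral_value_def)
  qed
  then obtain e where e: "d = Suc e" using not0_implies_Suc by blast
  have "\<exists>i j. H i j z \<noteq> 0"
  proof (rule ccontr)
    assume "\<not> ?thesis"
    then have "\<forall>i j. \<exists>k. k analytic_on {z} \<and> (\<forall>\<^sub>F w in at z. H i j w = (w - z) * k w)"
      using H by (intro allI analytic_divide_out_zero) (auto simp: P_def)
    then have "\<exists>k. \<forall>i j. k i j analytic_on {z} \<and> (\<forall>\<^sub>F w in at z. H i j w = (w - z) * k i j w)"
      by (simp only: choice_iff)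
    then obtain k where k: "\<And>i j. k i j analytic_on {z}"
      "\<And>i j. \<forall>\<^sub>F w in at z. H i j w = (w - z) * k i j w" by blast
    have "P e k"
      unfolding P_def
    proof (intro allI conjI k)
      fix i j
      have "\<forall>\<^sub>F w in at z. (w - z) ^ d * matrix_inv (\<iota> w) $ i $ j = H i j w" using H by (simp add: P_def)
      moreover have "\<forall>\<^sub>F w in at z. w \<noteq> z" by (simp add: eventually_at_filter)
      ultimately show "\<forall>\<^sub>F w in at z. (w - z) ^ e * matrix_inv (\<iota> w) $ i $ j = k i j w"
        using k(2)[of i j] by eventually_elim (simp add: e)
    qed
    then have "d \<le> e" unfolding d_def by (intro Least_le) blast
    then show False by (simp add: e)
  qed
  then show ?thesis using H unfolding P_def e by blast
qed

lemma inverse_analytic_at_imp_invertible: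
  "inverse_analytic_at \<iota> z \<Longrightarrow> \<forall>\<^sub>F w in at z. invertible (\<iota> w)"
  unfolding inverse_analytic_at_def by (auto elim: eventually_mono)

text \<open>Regularity at a point is given by a local analytic representative of the inverse. Removing the
  removable singularities glues these representatives to one matrix function \<open>\<Phi>\<close> on the disc,
  which at \<open>z\<^sub>0\<close> takes the leading coefficient of the previous lemma as its value.\<close>

lemma resolvent_times_power_holomorphic:
  fixes \<iota> :: "complex \<Rightarrow> complex ^ 'n ^ 'n"
  assumes mero: "\<And>i j. (\<lambda>w. \<iota> w $ i $ j) meromorphic_on ball 0 M"
    and spectral: "spectral_value \<iota> z\<^sub>0" "norm z\<^sub>0 < M"
    and unique: "\<And>z. norm z < M \<Longrightarrow> z \<noteq> z\<^sub>0 \<Longrightarrow> \<not> spectral_value \<iota> z"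
  shows "\<exists>e \<Phi>. (\<forall>i j. (\<lambda>w. \<Phi> w $ i $ j) holomorphic_on ball 0 M) \<and> \<Phi> z\<^sub>0 \<noteq> (0 :: complex ^ 'n ^ 'n) \<and>
    (\<forall>z\<in>ball 0 M. \<forall>\<^sub>F w in at z. invertible (\<iota> w) \<and> \<Phi> w ** \<iota> w = mat ((w - z\<^sub>0) ^ Suc e) \<and>
       \<iota> w ** \<Phi> w = mat ((w - z\<^sub>0) ^ Suc e))"
proof -
  have reg: "inverse_analytic_at \<iota> z" if "z \<in> ball 0 M" "z \<noteq> z\<^sub>0" for z
    using unique that by (simp add: spectral_value_def)
  have mero_at: "(\<lambda>w. \<iota> w $ i $ j) meromorphic_on {z\<^sub>0}" for i j
    using meromorphic_on_subset[OF mero] spectral(2) by fastforce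
  have "\<forall>\<^sub>F w in at z\<^sub>0. w \<in> ball 0 M - {z\<^sub>0}"
    using spectral(2) by (intro eventually_at_in_open) auto
  then have "\<forall>\<^sub>F w in at z\<^sub>0. \<forall>\<^sub>F v in at w. invertible (\<iota> v)"
    by eventually_elim (rule inverse_analytic_at_imp_invertible[OF reg], auto)
  then have inv0: "\<forall>\<^sub>F w in at z\<^sub>0. invertible (\<iota> w)"
    by (intro eventually_invertible_if_accumulation mero_at)
  obtain e H where H: "\<And>i j. H i j analytic_on {z\<^sub>0}"
      "\<And>i j. \<forall>\<^sub>F w in at z\<^sub>0. (w - z\<^sub>0) ^ Suc e * matrix_inv (\<iota> w) $ i $ j = H i j w"
      and Hnz: "\<exists>i j. H i j z\<^sub>0 \<noteq> 0"
    using resolvent_leading_term[OF mero_at inv0 spectral(1)] by blast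
  define f where "f i j w = (w - z\<^sub>0) ^ Suc e * matrix_inv (\<iota> w) $ i $ j" for i j w
  have local: "\<exists>g. g analytic_on {z} \<and> (\<forall>\<^sub>F w in at z. f i j w = g w)" if z: "z \<in> ball 0 M" for z i j
  proof (cases "z = z\<^sub>0")
    case True
    then show ?thesis using H[of i j] unfolding f_def by blast
  next
    case False
    obtain g :: "complex \<Rightarrow> complex ^ 'n ^ 'n" where g: "\<forall>i j. (\<lambda>w. g w $ i $ j) analytic_on {z}"
      "\<forall>\<^sub>F w in at z. invertible (\<iota> w) \<and> g w = matrix_inv (\<iota> w)"
      using reg[OF z False] unfolding inverse_analytic_at_def by blast
    have "(\<lambda>w. (w - z\<^sub>0) ^ Suc e * g w $ i $ j) analytic_on {z}" using g(1) by (intro analytic_intros) auto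
    moreover have "\<forall>\<^sub>F w in at z. f i j w = (w - z\<^sub>0) ^ Suc e * g w $ i $ j"
      using g(2) by eventually_elim (simp add: f_def)
    ultimately show ?thesis by (intro exI conjI)
  qed
  have inv: "\<forall>\<^sub>F w in at z. invertible (\<iota> w)" if "z \<in> ball 0 M" for z
    using inv0 inverse_analytic_at_imp_invertible[OF reg[OF that]] by (cases "z = z\<^sub>0") auto
  define \<Phi> where "\<Phi> w = (\<chi> i j. remove_sings (f i j) w)" for w
  have "(\<lambda>w. \<Phi> w $ i $ j) holomorphic_on ball 0 M" for i j
  proof -
    have "remove_sings (f i j) analytic_on {z}" if "z \<in> ball 0 M" for z
      using local[OF that, of i j] remove_sings_of_eventually_analytic(1) by blast
    then have "remove_sings (f i j) analytic_on ball 0 M" using analytic_on_analytic_at by blast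
    then show ?thesis by (simp add: \<Phi>_def analytic_imp_holomorphic)
  qed
  moreover have "\<Phi> z\<^sub>0 \<noteq> 0"
  proof -
    have "remove_sings (f i j) z\<^sub>0 = H i j z\<^sub>0" for i j
      unfolding f_def by (rule remove_sings_of_eventually_analytic(2)[OF H])
    then have "\<Phi> z\<^sub>0 $ i $ j = H i j z\<^sub>0" for i j by (simp add: \<Phi>_def)
    then show ?thesis using Hnz by (metis zero_index)
  qed
  moreover have "\<forall>\<^sub>F w in at z. invertible (\<iota> w) \<and> \<Phi> w ** \<iota> w = mat ((w - z\<^sub>0) ^ Suc e) \<and>
       \<iota> w ** \<Phi> w = mat ((w - z\<^sub>0) ^ Suc e)" if z: "z \<in> ball 0 M" for z
  proof -
    have "\<forall>\<^sub>F w in at z. \<forall>i\<in>UNIV. \<forall>j\<in>UNIV. remove_sings (f i j) w = f i j w"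
    proof (intro eventually_ball_finite ballI)
      fix i j
      show "\<forall>\<^sub>F w in at z. remove_sings (f i j) w = f i j w"
        using local[OF z, of i j] remove_sings_of_eventually_analytic(3) by blast
    qed simp_all
    then show ?thesis using inv[OF z]
    proof eventually_elim
      case (elim w)
      then have "\<Phi> w = (\<chi> i j. (w - z\<^sub>0) ^ Suc e * matrix_inv (\<iota> w) $ i $ j)"
        by (simp add: \<Phi>_def f_def)
      then show ?case
        using elim scaled_matrix_mult matrix_inv_inverse by metis
    qed
  qed
  ultimately show ?thesis by blast
qed

lemma inverse_analytic_at_of_invertible:
  fixes \<iota> :: "complex \<Rightarrow> complex ^ 'n ^ 'n"
  assumes hol: "\<And>i j. (\<lambda>w. \<iota> w $ i $ j) analytic_on {z}" and inv: "invertible (\<iota> z)"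
  shows "inverse_analytic_at \<iota> z"
proof -
  have det: "(\<lambda>w. det (B w)) analytic_on {z}" if "\<And>i j. (\<lambda>w. B w $ i $ j) analytic_on {z}"
    for B :: "complex \<Rightarrow> complex ^ 'n ^ 'n"
    unfolding det_def by (intro analytic_intros that)
  have d0: "det (\<iota> z) \<noteq> 0" using inv invertible_det_nz by blast
  define g where "g w = (\<chi> i j. det (\<chi> k l. if l = i then axis j 1 $ k else \<iota> w $ k $ l) / det (\<iota> w))" for w
  have "(\<lambda>w. g w $ i $ j) analytic_on {z}" for i j
  proof -
    have "(\<lambda>w. (\<chi> k l. if l = i then axis j 1 $ k else \<iota> w $ k $ l) $ p $ q) analytic_on {z}" for p q
      using hol by (cases "q = i") auto
    then have "(\<lambda>w. det (\<chi> k l. if l = i then axis j 1 $ k else \<iota> w $ k $ l)) analytic_on {z}"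
      by (rule det)
    then show ?thesis
      unfolding g_def vec_lambda_beta by (rule analytic_on_divide) (use det[OF hol] d0 in auto)
  qed
  moreover have "\<forall>\<^sub>F w in at z. det (\<iota> w) \<noteq> 0"
    by (rule tendsto_imp_eventually_ne[OF _ d0])
      (use analytic_at_imp_isCont[OF det[OF hol]] in \<open>simp add: isCont_def\<close>)
  then have "\<forall>\<^sub>F w in at z. invertible (\<iota> w) \<and> g w = matrix_inv (\<iota> w)"
    by eventually_elim (simp add: g_def invertible_det_nz vec_eq_iff matrix_inv_entry_cramer)
  ultimately show ?thesis unfolding inverse_analytic_at_def by blast
qed

lemma spectral_value_nonzero:
  fixes \<iota> :: "complex \<Rightarrow> complex ^ 'n ^ 'n"
  assumes ser: "r > 0" "\<And>z i j. z \<in> ball 0 r \<Longrightarrow> (\<lambda>k. a k $ i $ j * z ^ k) sums (\<iota> z $ i $ j)"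
    and inv: "invertible (a 0)" and spectral: "spectral_value \<iota> z\<^sub>0"
  shows "z\<^sub>0 \<noteq> 0"
proof
  assume "z\<^sub>0 = 0"
  have exp: "(\<lambda>w. \<iota> w $ i $ j) has_fps_expansion Abs_fps (\<lambda>k. a k $ i $ j)" for i j
    by (rule power_series_has_fps_expansion[OF ser])
  have "\<iota> 0 $ i $ j = a 0 $ i $ j" for i j
    using has_fps_expansion_imp_0_eq_fps_nth_0[OF exp[of i j]] by simp
  then have "invertible (\<iota> 0)" using inv by (metis vec_eq_iff)
  moreover have "(\<lambda>w. \<iota> w $ i $ j) analytic_on {0}" for i j
    by (rule has_fps_expansion_imp_analytic_0[OF exp])
  ultimately have "inverse_analytic_at \<iota> 0" by (intro inverse_analytic_at_of_invertible)
  then show False using spectral \<open>z\<^sub>0 = 0\<close> by (simp add: spectral_value_def)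
qed

section \<open>Root vectors at a pole of the inverse\<close>

lemma tendsto_scale_vec:
  assumes "(c \<longlongrightarrow> c') F" "(f \<longlongrightarrow> (f' :: complex ^ 'n)) F"
  shows "((\<lambda>x. c x *s f x) \<longlongrightarrow> c' *s f') F"
  by (rule vec_tendstoI) (use assms in \<open>auto intro!: tendsto_mult tendsto_vec_nth\<close>)

lemma matrix_vector_scale: "(A :: complex ^ 'n ^ 'm) *v (c *s x) = c *s (A *v x)"
  by (simp add: vec_eq_iff matrix_vector_mult_def sum_distrib_left mult.left_commute)

text \<open>The root function is \<open>\<Phi> P\<close>; the power of \<open>w - z\<close> in \<open>\<iota> \<Phi> P = (w - z)\<^sup>e\<^sup>+\<^sup>1 P\<close> drives it to \<open>0\<close>.\<close>

lemma root_vector_of_resolvent: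
  fixes \<iota> \<Phi> :: "complex \<Rightarrow> complex ^ 'n ^ 'n"
  assumes prod: "\<forall>\<^sub>F w in at z. \<iota> w ** \<Phi> w = mat ((w - z) ^ Suc e)"
    and hol: "\<And>i j. (\<lambda>w. \<Phi> w $ i $ j) analytic_on {z}" and P: "\<And>i. (\<lambda>w. P w $ i) analytic_on {z}"
  shows "root_vector \<iota> z (\<Phi> z *v P z)"
  unfolding root_vector_def
proof (intro exI[of _ "\<lambda>w. \<Phi> w *v P w"] conjI allI)
  fix i show "(\<lambda>w. (\<Phi> w *v P w) $ i) analytic_on {z}"
    unfolding matrix_vector_mult_def vec_lambda_beta by (intro analytic_intros hol P)
next
  have "((\<lambda>w. (w - z) ^ Suc e) \<longlongrightarrow> (z - z) ^ Suc e) (at z)" by (intro tendsto_intros)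
  moreover have "(P \<longlongrightarrow> P z) (at z)"
    by (rule vec_tendstoI) (use analytic_at_imp_isCont[OF P] in \<open>simp add: isCont_def\<close>)
  ultimately have "((\<lambda>w. (w - z) ^ Suc e *s P w) \<longlongrightarrow> (z - z) ^ Suc e *s P z) (at z)"
    by (rule tendsto_scale_vec)
  moreover have "\<forall>\<^sub>F w in at z. (w - z) ^ Suc e *s P w = \<iota> w *v (\<Phi> w *v P w)"
    using prod
  proof eventually_elim
    case (elim w)
    have "mat c *v x = c *s x" for c and x :: "complex ^ 'n"
      by (simp add: vec_eq_iff matrix_vector_mult_def mat_def if_distrib[of "\<lambda>x. x * _"] cong: if_cong)
    then show ?case by (simp add: matrix_vector_mul_assoc elim)
  qed
  ultimately show "((\<lambda>w. \<iota> w *v (\<Phi> w *v P w)) \<longlongrightarrow> 0) (at z)"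
    by (auto dest: Lim_transform_eventually)
qed simp

lemma root_vector_scale:
  assumes "root_vector \<iota> z v"
  shows "root_vector \<iota> z (c *s v)"
proof -
  obtain f where f: "\<forall>i. (\<lambda>w. f w $ i) analytic_on {z}" "f z = v" "((\<lambda>w. \<iota> w *v f w) \<longlongrightarrow> 0) (at z)"
    using assms unfolding root_vector_def by blast
  have "((\<lambda>w. c *s (\<iota> w *v f w)) \<longlongrightarrow> c *s 0) (at z)"
    by (rule tendsto_scale_vec[OF tendsto_const f(3)])
  then show ?thesis
    unfolding root_vector_def using f(1,2)
    by (intro exI[of _ "\<lambda>w. c *s f w"]) (auto simp: matrix_vector_scale intro!: analytic_intros)
qed

text \<open>Where the pencil is analytic, being a kernel vector refers to the value at the point, and
  there both notions agree.\<close>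

lemma in_kernel_at_if_root_vector: "root_vector \<iota> z v \<Longrightarrow> in_kernel_at \<iota> z v"
  using root_vector_iff_if_analytic unfolding in_kernel_at_def by auto

section \<open>Sequences and linear maps between them\<close>

lemma compactly_supported_iff: "u \<in> compactly_supported \<longleftrightarrow> (\<exists>K\<ge>1. u \<in> supported_upto K)"
proof
  assume u: "u \<in> compactly_supported"
  then obtain N where N: "\<And>j. u j \<noteq> 0 \<Longrightarrow> j \<le> N"
    unfolding compactly_supported_def using finite_nat_set_iff_bounded_le by auto
  have "u \<in> supported_upto (Suc N)"
    unfolding supported_upto_def
  proof safe
    fix j assume "j \<notin> {1..Suc N}"
    then consider "j = 0" | "j > N" by force
    then show "u j = 0" using u N by cases (auto simp: compactly_supported_def not_le[symmetric])
  qed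
  then show "\<exists>K\<ge>1. u \<in> supported_upto K" by (intro exI[of _ "Suc N"]) auto
next
  assume "\<exists>K\<ge>1. u \<in> supported_upto K"
  then obtain K where K: "u \<in> supported_upto K" by blast
  then have "{j. u j \<noteq> 0} \<subseteq> {1..K}" by (auto simp: supported_upto_def simp del: atLeastAtMost_iff)
  then have "finite {j. u j \<noteq> 0}" by (rule finite_subset) simp
  then show "u \<in> compactly_supported" using K by (auto simp: supported_upto_def compactly_supported_def)
qed

lemma supported_upto_mono: "K \<le> L \<Longrightarrow> supported_upto K \<subseteq> supported_upto L"
  by (auto simp: supported_upto_def)

lemma supported_upto_compactly: "u \<in> supported_upto K \<Longrightarrow> u \<in> compactly_supported"
  unfolding compactly_supported_iff using supported_upto_mono[of K "max K 1"]
  by (intro exI[of _ "max K 1"]) auto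

lemma subspace_supported_upto: "cseq.subspace (supported_upto K)"
  by (auto simp: cseq.subspace_def supported_upto_def seq_scale_def)

lemma subspace_compactly_supported: "cseq.subspace compactly_supported"
  unfolding cseq.subspace_def
proof (intro conjI ballI allI)
  show "0 \<in> compactly_supported"
    by (rule supported_upto_compactly[OF cseq.subspace_0[OF subspace_supported_upto]])
next
  fix u v :: "'n::finite cseq"
  assume "u \<in> compactly_supported" "v \<in> compactly_supported"
  then obtain K L where "u \<in> supported_upto K" "v \<in> supported_upto L"
    unfolding compactly_supported_iff by blast
  then have "u \<in> supported_upto (max K L)" "v \<in> supported_upto (max K L)"
    using supported_upto_mono[of K "max K L"] supported_upto_mono[of L "max K L"] by auto
  then show "u + v \<in> compactly_supported"
    by (rule supported_upto_compactly[OF cseq.subspace_add[OF subspace_supported_upto]])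
next
  fix c and u :: "'n::finite cseq"
  assume "u \<in> compactly_supported"
  then obtain K where "u \<in> supported_upto K" unfolding compactly_supported_iff by blast
  then show "seq_scale c u \<in> compactly_supported"
    by (rule supported_upto_compactly[OF cseq.subspace_scale[OF subspace_supported_upto]])
qed

text \<open>Linearity is asked for on compactly supported sequences only: elsewhere the sum in the first
  component of the companion operator can have infinitely many terms and is then \<open>0\<close> by convention.\<close>

definition seq_linear :: "('n::finite cseq \<Rightarrow> 'n cseq) \<Rightarrow> bool" where
  "seq_linear F \<longleftrightarrow>
     (\<forall>u\<in>compactly_supported. \<forall>v\<in>compactly_supported. F (u + v) = F u + F v) \<and>
     (\<forall>c. \<forall>u\<in>compactly_supported. F (seq_scale c u) = seq_scale c (F u))"

lemma seq_linear_diff: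
  assumes F: "seq_linear F" and "u \<in> compactly_supported" "v \<in> compactly_supported"
  shows "F (u - v) = F u - F v"
proof -
  have "u - v \<in> compactly_supported"
    by (rule cseq.subspace_diff[OF subspace_compactly_supported assms(2,3)])
  then have "F ((u - v) + v) = F (u - v) + F v"
    using F assms(3) unfolding seq_linear_def by blast
  then show ?thesis by simp
qed

lemma seq_linear_scale_comp:
  "seq_linear F \<Longrightarrow> seq_linear (\<lambda>u. seq_scale c (F u))"
  by (simp add: seq_linear_def cseq.scale_right_distrib cseq.scale_left_commute del: cseq.scale_scale)

lemma seq_linear_diff_comp:
  "seq_linear F \<Longrightarrow> seq_linear G \<Longrightarrow> seq_linear (\<lambda>u. F u - G u)"
  by (simp add: seq_linear_def cseq.scale_right_diff_distrib)

lemma norm_scale_vec: "norm (c *s (v :: complex ^ 'n)) = norm c * norm v"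
  by (simp add: norm_vec_def norm_mult L2_set_right_distrib)

lemma restr_norm_nonneg: "0 \<le> restr_norm K u"
  by (simp add: restr_norm_def L2_set_nonneg)

lemma restr_norm_scale: "restr_norm K (seq_scale c u) = norm c * restr_norm K u"
  by (simp add: restr_norm_def seq_scale_def norm_scale_vec L2_set_right_distrib)

lemma restr_norm_triangle: "restr_norm K (u + v) \<le> restr_norm K u + restr_norm K v"
proof -
  have "restr_norm K (u + v) \<le> L2_set (\<lambda>j. norm (u j) + norm (v j)) {1..K}"
    unfolding restr_norm_def by (intro L2_set_mono) (auto simp: norm_triangle_ineq)
  also have "\<dots> \<le> restr_norm K u + restr_norm K v"
    unfolding restr_norm_def by (rule L2_set_triangle_ineq)
  finally show ?thesis .
qed

lemma restr_norm_minus_commute: "restr_norm K (u - v) = restr_norm K (v - u)"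
  by (simp add: restr_norm_def norm_minus_commute)

lemma restr_norm_triangle_sub: "restr_norm K u \<le> restr_norm K v + restr_norm K (u - v)"
  using restr_norm_triangle[of K v "u - v"] by simp

lemma restr_norm_triangle_diff: "restr_norm K (u - v) \<le> restr_norm K u + restr_norm K v"
  using restr_norm_triangle_sub[of K "u - v" u] restr_norm_minus_commute[of K]
  by (simp add: restr_norm_def)

lemma restr_norm_sum: "finite A \<Longrightarrow> restr_norm K (\<Sum>x\<in>A. f x) \<le> (\<Sum>x\<in>A. restr_norm K (f x))"
proof (induction A rule: finite_induct)
  case empty
  then show ?case by (simp add: restr_norm_def L2_set_def)
next
  case (insert x A)
  have "restr_norm K (sum f (insert x A)) = restr_norm K (f x + sum f A)"
    by (simp only: sum.insert insert.hyps not_False_eq_True)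
  also have "\<dots> \<le> restr_norm K (f x) + restr_norm K (sum f A)" by (rule restr_norm_triangle)
  also have "\<dots> \<le> (\<Sum>x\<in>insert x A. restr_norm K (f x))"
    using insert.IH insert.hyps by simp
  finally show ?case .
qed

lemma norm_le_restr_norm: "j \<in> {1..K} \<Longrightarrow> norm (u j) \<le> restr_norm K u"
  unfolding restr_norm_def by (rule member_le_L2_set) auto

lemma restr_norm_tendsto_0:
  assumes "\<And>j. j \<in> {1..K} \<Longrightarrow> (\<lambda>k. u k j) \<longlonglongrightarrow> 0"
  shows "(\<lambda>k. restr_norm K (u k)) \<longlonglongrightarrow> 0"
proof (rule tendsto_sandwich[of "\<lambda>_. 0"])
  show "\<forall>\<^sub>F k in sequentially. restr_norm K (u k) \<le> (\<Sum>j\<in>{1..K}. norm (u k j))"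
    unfolding restr_norm_def by (intro always_eventually allI L2_set_le_sum) auto
  show "(\<lambda>k. \<Sum>j\<in>{1..K}. norm (u k j)) \<longlonglongrightarrow> 0"
    using assms by (intro tendsto_null_sum tendsto_norm_zero)
qed (auto simp: restr_norm_nonneg)

lemma normalized_scale:
  "c \<noteq> 0 \<Longrightarrow> normalized K (seq_scale c u) = seq_scale (sgn c) (normalized K u)"
  by (simp add: normalized_def restr_norm_scale sgn_div_norm scaleR_conv_of_real mult_ac)

lemma restr_norm_normalized: "restr_norm K u \<noteq> 0 \<Longrightarrow> restr_norm K (normalized K u) = 1"
  using restr_norm_nonneg[of K u]
  by (simp add: normalized_def restr_norm_scale norm_inverse)

text \<open>The difference is \<open>(u - v) / \<bar>v\<bar>\<close> plus \<open>(\<bar>v\<bar> - \<bar>u\<bar>) / \<bar>v\<bar>\<close> times the normalisation of \<open>u\<close>. The bound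
  covers a vanishing restriction of \<open>u\<close>, whose normalisation is \<open>0\<close>: early iterates can vanish there.\<close>

lemma restr_norm_normalized_diff:
  assumes v: "restr_norm K v > 0"
  shows "restr_norm K (normalized K u - normalized K v) \<le> 2 * restr_norm K (u - v) / restr_norm K v"
proof -
  define p q where "p = restr_norm K u" and "q = restr_norm K v"
  have pq: "\<bar>q - p\<bar> \<le> restr_norm K (u - v)"
    using restr_norm_triangle_sub[of K u v] restr_norm_triangle_sub[of K v u]
      restr_norm_minus_commute[of K u v] by (simp add: p_def q_def)
  have "normalized K u - normalized K v =
      seq_scale (of_real (inverse q)) ((u - v) + seq_scale (of_real (q - p)) (normalized K u))
        \<or> p = 0"
  proof (cases "p = 0")
    case False
    then show ?thesis using v
      by (auto simp: normalized_def fun_eq_iff seq_scale_def p_def[symmetric] q_def[symmetric] vec_eq_iff field_simps)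
  qed simp
  then show ?thesis
  proof
    assume "p = 0"
    then have "normalized K u = 0"
      by (simp add: normalized_def p_def[symmetric] fun_eq_iff seq_scale_def)
    then have "restr_norm K (normalized K u - normalized K v) = 1"
      using restr_norm_normalized[of K v] v restr_norm_minus_commute[of K 0 "normalized K v"] by simp
    also have "\<dots> \<le> 2 * restr_norm K (u - v) / q"
      using pq \<open>p = 0\<close> v unfolding q_def[symmetric] by (simp add: field_simps)
    finally show ?thesis by (simp add: q_def)
  next
    assume eq: "normalized K u - normalized K v =
      seq_scale (of_real (inverse q)) ((u - v) + seq_scale (of_real (q - p)) (normalized K u))"
    have "restr_norm K (normalized K u) \<le> 1"
      using restr_norm_normalized[of K u] by (cases "restr_norm K u = 0") (auto simp: normalized_def restr_norm_def L2_set_def)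
    then have "\<bar>q - p\<bar> * restr_norm K (normalized K u) \<le> restr_norm K (u - v)"
      using pq by (meson abs_ge_zero mult_left_le order_trans)
    then have "restr_norm K ((u - v) + seq_scale (of_real (q - p)) (normalized K u)) \<le> 2 * restr_norm K (u - v)"
      using restr_norm_triangle[of K "u - v" "seq_scale (of_real (q - p)) (normalized K u)"]
      by (simp add: restr_norm_scale del: of_real_diff)
    then have "inverse q * restr_norm K ((u - v) + seq_scale (of_real (q - p)) (normalized K u))
       \<le> inverse q * (2 * restr_norm K (u - v))"
      using v by (intro mult_left_mono) (auto simp: q_def)
    moreover have "norm (complex_of_real (inverse q)) = inverse q"
      using v by (simp add: q_def norm_inverse)
    ultimately have "restr_norm K (normalized K u - normalized K v) \<le> inverse q * (2 * restr_norm K (u - v))"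
      unfolding eq restr_norm_scale by simp
    then show ?thesis by (simp add: q_def divide_inverse mult.commute)
  qed
qed

definition unit_seq :: "nat \<times> 'n \<Rightarrow> 'n::finite cseq" where
  "unit_seq p = (\<lambda>m. if m = fst p then axis (snd p) 1 else 0)"

lemma sum_fun_apply: "(\<Sum>x\<in>A. f x) j = (\<Sum>x\<in>A. f x j)"
  by (induction A rule: infinite_finite_induct) auto

lemma unit_seq_supported_upto: "p \<in> {1..K} \<times> UNIV \<Longrightarrow> unit_seq p \<in> supported_upto K"
  by (auto simp: unit_seq_def supported_upto_def)

lemma unit_seq_expansion:
  assumes "u \<in> supported_upto K"
  shows "u = (\<Sum>p\<in>{1..K} \<times> UNIV. seq_scale (u (fst p) $ snd p) (unit_seq p))"
proof
  fix m
  have "(\<Sum>p\<in>{1..K} \<times> UNIV. seq_scale (u (fst p) $ snd p) (unit_seq p)) m =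
      (\<Sum>j\<in>{1..K}. \<Sum>i\<in>UNIV. u j $ i *s (if m = j then axis i 1 else 0))"
    by (simp only: sum_fun_apply sum.cartesian_product' seq_scale_def unit_seq_def fst_conv snd_conv)
  also have "\<dots> = (\<Sum>j\<in>{1..K}. if m = j then (\<Sum>i\<in>UNIV. u j $ i *s axis i 1) else 0)"
    by (intro sum.cong) auto
  also have "\<dots> = u m"
    using assms by (auto simp: basis_expansion supported_upto_def)
  finally show "u m = (\<Sum>p\<in>{1..K} \<times> UNIV. seq_scale (u (fst p) $ snd p) (unit_seq p)) m" by simp
qed

lemma seq_linear_combination:
  assumes "seq_linear F" "finite A" "\<And>x. x \<in> A \<Longrightarrow> e x \<in> compactly_supported"
  shows "F (\<Sum>x\<in>A. seq_scale (c x) (e x)) = (\<Sum>x\<in>A. seq_scale (c x) (F (e x)))"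
  using assms(2,3)
proof (induction A rule: finite_induct)
  case empty
  have "F (seq_scale 0 0) = seq_scale 0 (F 0)"
    using assms(1) cseq.subspace_0[OF subspace_compactly_supported] unfolding seq_linear_def by blast
  then show ?case by (simp only: sum.empty cseq.scale_zero_left)
next
  case (insert x A)
  have x: "e x \<in> compactly_supported" using insert by simp
  have "(\<Sum>x\<in>A. seq_scale (c x) (e x)) \<in> compactly_supported"
    using insert.prems
    by (intro cseq.subspace_sum cseq.subspace_scale subspace_compactly_supported) auto
  moreover have "seq_scale (c x) (e x) \<in> compactly_supported"
    by (rule cseq.subspace_scale[OF subspace_compactly_supported x])
  ultimately have "F (seq_scale (c x) (e x) + (\<Sum>x\<in>A. seq_scale (c x) (e x))) =
    F (seq_scale (c x) (e x)) + F (\<Sum>x\<in>A. seq_scale (c x) (e x))"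
    using assms(1) unfolding seq_linear_def by blast
  moreover have "F (seq_scale (c x) (e x)) = seq_scale (c x) (F (e x))"
    using assms(1) x unfolding seq_linear_def by blast
  ultimately show ?case
    using insert.IH insert.prems by (simp only: sum.insert insert.hyps not_False_eq_True insert_iff simp_thms)
qed

text \<open>An explicit operator norm bound on the finite-dimensional space of sequences supported in \<open>1..K\<close>. Applied
  to a sequence of maps it turns convergence on the unit sequences into uniform
  convergence.\<close>

lemma seq_linear_bound:
  assumes F: "seq_linear F" and u: "u \<in> supported_upto K"
  shows "restr_norm K\<^sub>0 (F u) \<le>
    (\<Sum>p\<in>{1..K} \<times> UNIV. restr_norm K\<^sub>0 (F (unit_seq p))) * restr_norm K u"
proof -
  have "F u = F (\<Sum>p\<in>{1..K} \<times> UNIV. seq_scale (u (fst p) $ snd p) (unit_seq p))"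
    using unit_seq_expansion[OF u] by simp
  also have "\<dots> = (\<Sum>p\<in>{1..K} \<times> UNIV. seq_scale (u (fst p) $ snd p) (F (unit_seq p)))"
    by (rule seq_linear_combination[OF F]) (auto intro!: supported_upto_compactly[of _ K] unit_seq_supported_upto)
  finally have "restr_norm K\<^sub>0 (F u) \<le>
      (\<Sum>p\<in>{1..K} \<times> UNIV. restr_norm K\<^sub>0 (seq_scale (u (fst p) $ snd p) (F (unit_seq p))))"
    using restr_norm_sum[of "{1..K} \<times> UNIV" K\<^sub>0 "\<lambda>p. seq_scale (u (fst p) $ snd p) (F (unit_seq p))"]
    by simp
  also have "\<dots> \<le> (\<Sum>p\<in>{1..K} \<times> UNIV. restr_norm K\<^sub>0 (F (unit_seq p)) * restr_norm K u)"
  proof (rule sum_mono)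
    fix p :: "nat \<times> 'a" assume "p \<in> {1..K} \<times> UNIV"
    then have "norm (u (fst p) $ snd p) \<le> restr_norm K u"
      by (intro order_trans[OF Finite_Cartesian_Product.norm_nth_le norm_le_restr_norm]) auto
    then show "restr_norm K\<^sub>0 (seq_scale (u (fst p) $ snd p) (F (unit_seq p))) \<le>
        restr_norm K\<^sub>0 (F (unit_seq p)) * restr_norm K u"
      unfolding restr_norm_scale by (subst mult.commute) (intro mult_left_mono restr_norm_nonneg)
  qed
  also have "\<dots> = (\<Sum>p\<in>{1..K} \<times> UNIV. restr_norm K\<^sub>0 (F (unit_seq p))) * restr_norm K u"
    by (simp add: sum_distrib_right)
  finally show ?thesis .
qed

text \<open>Preimages of a basis of the range, which lies in \<open>\<complex>\<^sup>N\<close>, span a complement of the kernel.\<close>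

lemma kernel_finite_codim:
  fixes L :: "'n::finite cseq \<Rightarrow> complex ^ 'n"
  assumes V: "cseq.subspace V"
    and add: "\<And>u v. u \<in> V \<Longrightarrow> v \<in> V \<Longrightarrow> L (u + v) = L u + L v"
    and scale: "\<And>c u. u \<in> V \<Longrightarrow> L (seq_scale c u) = c *s L u"
  shows "cseq.subspace {u \<in> V. L u = 0}" and "finite_codim {u \<in> V. L u = 0} V"
proof -
  have L0: "L 0 = 0" using scale[of 0 0] cseq.subspace_0[OF V] by simp
  show "cseq.subspace {u \<in> V. L u = 0}"
    using V L0 by (auto simp: cseq.subspace_def add scale)
  obtain B' where B': "B' \<subseteq> L ` V" "vec.independent B'" "L ` V \<subseteq> vec.span B'"
    using vec.maximal_independent_subset[of "L ` V"] by blast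
  have "finite B'" using B'(2) vec.finiteI_independent by blast
  obtain B where B: "B \<subseteq> V" "finite B" "B' = L ` B"
    using finite_subset_image[OF \<open>finite B'\<close> B'(1)] by blast
  have "u \<in> cseq.span ({u \<in> V. L u = 0} \<union> B)" if u: "u \<in> V" for u
  proof -
    have lift: "\<exists>w\<in>cseq.span B. w \<in> V \<and> L w = y" if "y \<in> vec.span B'" for y
      using that
    proof (induction rule: vec.span_induct_alt)
      case base
      then show ?case using cseq.span_zero cseq.subspace_0[OF V] L0 by blast
    next
      case (step c x y)
      then obtain b w where bw: "b \<in> B" "L b = x" "w \<in> cseq.span B" "w \<in> V" "L w = y" using B by blast
      have "b \<in> V" using bw B by blast
      then have "seq_scale c b + w \<in> V"
        by (intro cseq.subspace_add[OF V] cseq.subspace_scale[OF V] bw)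
      moreover have "L (seq_scale c b + w) = c *s x + y"
        using bw \<open>b \<in> V\<close> cseq.subspace_scale[OF V] by (simp add: add scale)
      moreover have "seq_scale c b + w \<in> cseq.span B"
        by (intro cseq.span_add cseq.span_scale cseq.span_base bw)
      ultimately show ?case by blast
    qed
    then obtain w where w: "w \<in> cseq.span B" "w \<in> V" "L w = L u" using B'(3) u by blast
    have uw: "u - w \<in> V" by (rule cseq.subspace_diff[OF V u w(2)])
    have "L u = L (u - w) + L w" using add[OF uw w(2)] by simp
    then have "u - w \<in> {u \<in> V. L u = 0}" using uw w(3) by simp
    then have "u - w \<in> cseq.span ({u \<in> V. L u = 0} \<union> B)"
      by (intro cseq.span_base UnI1)
    moreover have "w \<in> cseq.span ({u \<in> V. L u = 0} \<union> B)"
      using w(1) cseq.span_mono[of B "{u \<in> V. L u = 0} \<union> B"] by blast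
    ultimately have "(u - w) + w \<in> cseq.span ({u \<in> V. L u = 0} \<union> B)"
      by (rule cseq.span_add)
    then show ?thesis by simp
  qed
  then show "finite_codim {u \<in> V. L u = 0} V" unfolding finite_codim_def using B(2) by blast
qed

section \<open>Iterates of the companion operator\<close>

lemma companion_op_simps:
  "companion_op a u 0 = 0"
  "j \<ge> 1 \<Longrightarrow> companion_op a u (Suc j) = u j"
  by (auto simp: companion_op_def)

lemma companion_op_first:
  assumes "u \<in> supported_upto N"
  shows "companion_op a u 1 = - (matrix_inv (a 0) *v (\<Sum>k=1..N. a k *v u k))"
proof -
  have "(\<Sum>k | k \<ge> 1 \<and> u k \<noteq> 0. a k *v u k) = (\<Sum>k=1..N. a k *v u k)"
    using assms by (intro sum.mono_neutral_left) (auto simp: supported_upto_def)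
  then show ?thesis by (simp add: companion_op_def)
qed

lemma companion_op_supported_upto:
  assumes "u \<in> supported_upto N"
  shows "companion_op a u \<in> supported_upto (Suc N)"
  unfolding supported_upto_def
proof safe
  fix j assume j: "j \<notin> {1..Suc N}"
  then have "j = 0 \<or> j > 1 \<and> j - 1 \<notin> {1..N}" by auto
  then show "companion_op a u j = 0"
    using assms by (auto simp: companion_op_def supported_upto_def)
qed

lemma companion_op_power_supported_upto:
  "u \<in> supported_upto N \<Longrightarrow> (companion_op a ^^ p) u \<in> supported_upto (N + p)"
  by (induction p) (auto dest: companion_op_supported_upto)

lemma companion_op_power_shift:
  "j \<ge> 1 \<Longrightarrow> (companion_op a ^^ (p + i)) u (j + i) = (companion_op a ^^ p) u j"
  by (induction i) (auto simp: companion_op_simps)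

lemma matrix_vector_minus: "(A :: complex ^ 'n ^ 'm) *v (- x) = - (A *v x)"
  by (simp add: vec_eq_iff matrix_vector_mult_def sum_negf)

text \<open>The \<open>K\<close>-th components of the iterates satisfy the recurrence of the pencil: by the shift
  property, each \<open>(A\<^sup>n\<^sup>-\<^sup>k u)\<^sub>K\<close> is the \<open>k\<close>-th component of the single iterate \<open>A\<^sup>n\<^sup>-\<^sup>K u\<close>, and its support ends at \<open>n\<close>.
  The sum is thus the equation defining the first component of \<open>A\<^sup>n\<^sup>-\<^sup>K\<^sup>+\<^sup>1 u\<close>, multiplied by \<open>a\<^sub>0\<close>.\<close>

lemma companion_op_power_recurrence:
  assumes u: "u \<in> supported_upto K" "K \<ge> 1" and "K \<le> n" and inv: "invertible (a 0)"
  shows "(\<Sum>k\<le>n. a k *v (companion_op a ^^ (n - k)) u K) = 0"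
proof -
  define p where "p = n - K"
  have n: "n = p + K" using \<open>K \<le> n\<close> by (simp add: p_def)
  have shift: "(companion_op a ^^ (n - k)) u K = (companion_op a ^^ p) u k" if "1 \<le> k" "k \<le> n" for k
  proof (cases "k \<le> K")
    case True
    then have "n - k = p + (K - k)" by (simp add: n)
    then show ?thesis
      using companion_op_power_shift[where j = k and p = p and i = "K - k"] that True by simp
  next
    case False
    then have "p = (n - k) + (k - K)" using that by (simp add: n)
    moreover have "K + (k - K) = k" using False by simp
    ultimately show ?thesis
      using companion_op_power_shift[where j = K and p = "n - k" and i = "k - K"] u(2) by metis
  qed
  have first: "(companion_op a ^^ n) u K = - (matrix_inv (a 0) *v (\<Sum>k=1..n. a k *v (companion_op a ^^ p) u k))"
  proof -
    have "(companion_op a ^^ (Suc p + (K - 1))) u (1 + (K - 1)) = (companion_op a ^^ Suc p) u 1"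
      by (rule companion_op_power_shift) simp
    then have "(companion_op a ^^ n) u K = companion_op a ((companion_op a ^^ p) u) 1"
      using u(2) by (simp add: n)
    moreover have "(companion_op a ^^ p) u \<in> supported_upto n"
      using companion_op_power_supported_upto[OF u(1)] unfolding n add.commute[of p] .
    ultimately show ?thesis by (simp only: companion_op_first)
  qed
  have "(\<Sum>k\<le>n. a k *v (companion_op a ^^ (n - k)) u K) =
      a 0 *v (companion_op a ^^ n) u K + (\<Sum>k=1..n. a k *v (companion_op a ^^ (n - k)) u K)"
    by (simp add: atMost_atLeast0 sum.atLeast_Suc_atMost)
  also have "(\<Sum>k=1..n. a k *v (companion_op a ^^ (n - k)) u K) = (\<Sum>k=1..n. a k *v (companion_op a ^^ p) u k)"
    by (intro sum.cong) (auto simp: shift)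
  also have "a 0 *v (companion_op a ^^ n) u K = - (\<Sum>k=1..n. a k *v (companion_op a ^^ p) u k)"
    using inv unfolding first
    by (simp add: matrix_vector_minus matrix_vector_mul_assoc matrix_inv_right)
  finally show ?thesis by simp
qed

lemma companion_op_compactly_supported:
  "u \<in> compactly_supported \<Longrightarrow> companion_op a u \<in> compactly_supported"
  by (metis companion_op_supported_upto compactly_supported_iff le_SucI)

lemma seq_linear_companion_op: "seq_linear (companion_op a)"
proof -
  have "companion_op a (u + v) = companion_op a u + companion_op a v"
    if uv: "u \<in> compactly_supported" "v \<in> compactly_supported" for u v
  proof -
    obtain K L where "u \<in> supported_upto K" "v \<in> supported_upto L"
      using uv unfolding compactly_supported_iff by blast
    then have N: "u \<in> supported_upto (max K L)" "v \<in> supported_upto (max K L)"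
      using supported_upto_mono[of K "max K L"] supported_upto_mono[of L "max K L"] by auto
    have "companion_op a (u + v) 1 = companion_op a u 1 + companion_op a v 1"
      using companion_op_first[OF N(1), of a] companion_op_first[OF N(2), of a]
        companion_op_first[OF cseq.subspace_add[OF subspace_supported_upto N], of a]
      by (simp add: matrix_vector_right_distrib sum.distrib)
    then show ?thesis by (auto simp: fun_eq_iff companion_op_def)
  qed
  moreover have "companion_op a (seq_scale c u) = seq_scale c (companion_op a u)"
    if u: "u \<in> compactly_supported" for c u
  proof -
    obtain K where N: "u \<in> supported_upto K" using u unfolding compactly_supported_iff by blast
    have "(\<Sum>k=1..K. a k *v (c *s u k)) = c *s (\<Sum>k=1..K. a k *v u k)"
      by (simp add: matrix_vector_scale vec.scale_sum_right)
    then have "companion_op a (seq_scale c u) 1 = c *s companion_op a u 1"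
      using companion_op_first[OF N, of a]
        companion_op_first[OF cseq.subspace_scale[OF subspace_supported_upto N], of a c]
      by (simp add: seq_scale_def matrix_vector_scale)
    then show ?thesis by (auto simp: fun_eq_iff companion_op_def seq_scale_def)
  qed
  ultimately show ?thesis by (simp add: seq_linear_def)
qed

lemma companion_op_power_compactly_supported:
  "u \<in> compactly_supported \<Longrightarrow> (companion_op a ^^ k) u \<in> compactly_supported"
  by (induction k) (auto intro: companion_op_compactly_supported)

lemma seq_linear_companion_op_power: "seq_linear (companion_op a ^^ k)"
proof (induction k)
  case (Suc k)
  then show ?case
    using seq_linear_companion_op[of a] companion_op_power_compactly_supported[where a = a and k = k]
    by (simp add: seq_linear_def)
qed (simp add: seq_linear_def)

section \<open>Limits of the scaled iterates\<close>

text \<open>The polynomial \<open>\<iota>(\<lambda>) \<Sum>\<^sub>m (A\<^sup>m u)\<^sub>K \<lambda>\<^sup>m\<close> for \<open>u\<close> supported in \<open>1..K\<close>. It depends on \<open>u\<close> only, because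
  \<open>(A\<^sup>m u)\<^sub>K = u\<^sub>K\<^sub>-\<^sub>m\<close> for \<open>m < K\<close>.\<close>

definition start_poly :: "(nat \<Rightarrow> complex ^ 'n ^ 'n) \<Rightarrow> 'n::finite cseq \<Rightarrow> nat \<Rightarrow> complex \<Rightarrow> complex ^ 'n" where
  "start_poly a u K w = (\<Sum>n<K. w ^ n *s (\<Sum>k\<le>n. a k *v (companion_op a ^^ (n - k)) u K))"

lemma start_poly_holomorphic: "(\<lambda>w. start_poly a u K w $ i) holomorphic_on S"
  unfolding start_poly_def by (simp add: holomorphic_intros)

lemma start_poly_single:
  fixes u :: "'n::finite cseq"
  shows "start_poly a u 1 w = a 0 *v u 1"
  by (simp add: start_poly_def)

lemma pencil_times_iterates_fps:
  assumes "u \<in> supported_upto K" "K \<ge> 1" "invertible (a 0)"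
  shows "(\<lambda>w. start_poly a u K w $ i) has_fps_expansion
    (\<Sum>j\<in>UNIV. Abs_fps (\<lambda>k. a k $ i $ j) * Abs_fps (\<lambda>m. (companion_op a ^^ m) u K $ j))"
proof -
  define p where "p n = (\<Sum>k\<le>n. a k *v (companion_op a ^^ (n - k)) u K)" for n
  have "fps_nth (\<Sum>j\<in>UNIV. Abs_fps (\<lambda>k. a k $ i $ j) * Abs_fps (\<lambda>m. (companion_op a ^^ m) u K $ j)) n
      = p n $ i" for n
  proof -
    have "fps_nth (\<Sum>j\<in>UNIV. Abs_fps (\<lambda>k. a k $ i $ j) * Abs_fps (\<lambda>m. (companion_op a ^^ m) u K $ j)) n
      = (\<Sum>j\<in>UNIV. \<Sum>k\<le>n. a k $ i $ j * (companion_op a ^^ (n - k)) u K $ j)"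
      by (simp add: fps_sum_nth fps_mult_nth atMost_atLeast0)
    also have "\<dots> = p n $ i"
      unfolding p_def by (subst sum.swap) (simp add: matrix_vector_mult_def)
    finally show ?thesis .
  qed
  moreover have "p n = 0" if "K \<le> n" for n
    unfolding p_def by (rule companion_op_power_recurrence[where a = a, OF assms(1,2) that assms(3)])
  moreover have "fps_nth (\<Sum>n<K. fps_X ^ n * fps_const (p n $ i)) m = (if m < K then p m $ i else 0)" for m
    by (simp add: fps_sum_nth fps_X_power_nth if_distribR if_distrib cong: if_cong)
  ultimately have "(\<Sum>j\<in>UNIV. Abs_fps (\<lambda>k. a k $ i $ j) * Abs_fps (\<lambda>m. (companion_op a ^^ m) u K $ j)) =
      (\<Sum>n<K. fps_X ^ n * fps_const (p n $ i))"
    by (auto simp: fps_eq_iff)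
  moreover have "(\<lambda>w. \<Sum>n<K. w ^ n * p n $ i) has_fps_expansion (\<Sum>n<K. fps_X ^ n * fps_const (p n $ i))"
    by (intro fps_expansion_intros)
  moreover have "(\<lambda>w. start_poly a u K w $ i) = (\<lambda>w. \<Sum>n<K. w ^ n * p n $ i)"
    by (simp add: start_poly_def p_def)
  ultimately show ?thesis by simp
qed

text \<open>Multiplying the formal identity \<open>\<iota> W = P\<close> by the expansion of \<open>\<Phi>\<close> at \<open>0\<close> gives \<open>(\<lambda> - z\<^sub>0)\<^sup>e\<^sup>+\<^sup>1 W = \<Phi> P\<close>, whose
  right-hand side is holomorphic in the whole disc.\<close>

lemma iterate_component_limit:
  fixes \<iota> \<Phi> :: "complex \<Rightarrow> complex ^ 'n ^ 'n"
  assumes ser: "r > 0" "\<And>z i j. z \<in> ball 0 r \<Longrightarrow> (\<lambda>k. a k $ i $ j * z ^ k) sums (\<iota> z $ i $ j)"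
    and inv: "invertible (a 0)"
    and hol: "\<And>i j. (\<lambda>w. \<Phi> w $ i $ j) holomorphic_on ball 0 M"
    and z0: "z\<^sub>0 \<noteq> 0" "norm z\<^sub>0 < M"
    and prod: "\<forall>\<^sub>F w in at 0. \<Phi> w ** \<iota> w = mat ((w - z\<^sub>0) ^ Suc e)"
    and u: "u \<in> supported_upto K" "K \<ge> 1"
  shows "(\<lambda>m. pole_weight z\<^sub>0 e m *s (companion_op a ^^ m) u K) \<longlonglongrightarrow>
    inverse ((- z\<^sub>0) ^ Suc e) *s (\<Phi> z\<^sub>0 *v start_poly a u K z\<^sub>0)"
proof (rule vec_tendstoI)
  fix k
  define I where "I i j = Abs_fps (\<lambda>k. a k $ i $ j)" for i j
  define W where "W j = Abs_fps (\<lambda>m. (companion_op a ^^ m) u K $ j)" for j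
  define F where "F i = fps_expansion (\<lambda>w. \<Phi> w $ k $ i) 0" for i
  define h where "h w = (\<Sum>i\<in>UNIV. \<Phi> w $ k $ i * start_poly a u K w $ i)" for w
  have M: "0 < M" using z0 by (metis norm_ge_zero le_less_trans)
  have F: "(\<lambda>w. \<Phi> w $ k $ i) has_fps_expansion F i" for i
    unfolding F_def by (intro has_fps_expansion_fps_expansion[of "ball 0 M"]) (use hol M in auto)
  have I: "(\<lambda>w. \<iota> w $ i $ j) has_fps_expansion I i j" for i j
    unfolding I_def by (rule power_series_has_fps_expansion[OF ser])
  have FI: "(\<Sum>i\<in>UNIV. F i * I i j) = (if k = j then (fps_X - fps_const z\<^sub>0) ^ Suc e else 0)" for j
  proof (rule has_fps_expansion_unique_at)
    show "(\<lambda>w. \<Sum>i\<in>UNIV. \<Phi> w $ k $ i * \<iota> w $ i $ j) has_fps_expansion (\<Sum>i\<in>UNIV. F i * I i j)"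
      by (intro fps_expansion_intros F I)
    show "(\<lambda>w. if k = j then (w - z\<^sub>0) ^ Suc e else 0) has_fps_expansion
        (if k = j then (fps_X - fps_const z\<^sub>0) ^ Suc e else 0)"
      by (cases "k = j") (auto intro!: fps_expansion_intros simp del: power_Suc)
    show "\<forall>\<^sub>F w in at 0. (\<Sum>i\<in>UNIV. \<Phi> w $ k $ i * \<iota> w $ i $ j) = (if k = j then (w - z\<^sub>0) ^ Suc e else 0)"
      using prod
    proof eventually_elim
      case (elim w)
      then have "(\<Phi> w ** \<iota> w) $ k $ j = mat ((w - z\<^sub>0) ^ Suc e) $ k $ j" by simp
      then show ?case by (simp add: matrix_matrix_mult_def mat_def)
    qed
  qed
  have "h has_fps_expansion (\<Sum>i\<in>UNIV. F i * (\<Sum>j\<in>UNIV. I i j * W j))"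
    unfolding h_def I_def W_def by (intro fps_expansion_intros F pencil_times_iterates_fps u inv)
  also have "(\<Sum>i\<in>UNIV. F i * (\<Sum>j\<in>UNIV. I i j * W j)) = (\<Sum>j\<in>UNIV. (\<Sum>i\<in>UNIV. F i * I i j) * W j)"
    unfolding sum_distrib_left sum_distrib_right by (subst sum.swap) (simp add: mult.assoc)
  also have "\<dots> = (fps_X - fps_const z\<^sub>0) ^ Suc e * W k"
    unfolding FI by (simp add: if_distrib[of "\<lambda>x. x * _"] cong: if_cong del: power_Suc)
  finally have "(fps_X - fps_const z\<^sub>0) ^ Suc e * W k = fps_expansion h 0"
    by (rule fps_expansion_eqI[symmetric])
  moreover have "h holomorphic_on ball 0 M"
    unfolding h_def by (intro holomorphic_intros hol start_poly_holomorphic)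
  ultimately have "(\<lambda>m. pole_weight z\<^sub>0 e m * fps_nth (W k) m) \<longlonglongrightarrow> h z\<^sub>0 / (- z\<^sub>0) ^ Suc e"
    using z0 by (intro fps_coeff_asymptotics_at_pole)
  moreover have "h z\<^sub>0 / (- z\<^sub>0) ^ Suc e = (inverse ((- z\<^sub>0) ^ Suc e) *s (\<Phi> z\<^sub>0 *v start_poly a u K z\<^sub>0)) $ k"
    by (simp add: h_def matrix_vector_mult_def divide_inverse mult.commute del: power_Suc)
  ultimately show "(\<lambda>m. (pole_weight z\<^sub>0 e m *s (companion_op a ^^ m) u K) $ k) \<longlonglongrightarrow>
      (inverse ((- z\<^sub>0) ^ Suc e) *s (\<Phi> z\<^sub>0 *v start_poly a u K z\<^sub>0)) $ k"
    by (simp add: W_def del: power_Suc)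
qed

text \<open>The next component is a copy delayed by one step, and the weights of consecutive steps have
  quotients tending to \<open>z\<^sub>0\<close>.\<close>

lemma iterate_limit_shift:
  assumes z0: "z\<^sub>0 \<noteq> 0" and "j \<ge> 1"
  shows "((\<lambda>k. pole_weight z\<^sub>0 e k *s (companion_op a ^^ k) u (Suc j)) \<longlonglongrightarrow> z\<^sub>0 ^ Suc j *s l) \<longleftrightarrow>
    ((\<lambda>k. pole_weight z\<^sub>0 e k *s (companion_op a ^^ k) u j) \<longlonglongrightarrow> z\<^sub>0 ^ j *s l)" (is "?f \<longlonglongrightarrow> _ \<longleftrightarrow> ?g \<longlonglongrightarrow> _")
proof -
  let ?q = "\<lambda>k. pole_weight z\<^sub>0 e (Suc k) / pole_weight z\<^sub>0 e k"
  have fg: "?f (Suc k) = ?q k *s ?g k" for k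
    using pole_weight_nonzero[OF z0] assms(2) by (simp add: companion_op_simps)
  have gf: "?g k = inverse (?q k) *s ?f (Suc k)" for k
    using pole_weight_nonzero[OF z0] unfolding fg by simp
  have z: "z\<^sub>0 ^ Suc j *s l = z\<^sub>0 *s (z\<^sub>0 ^ j *s l)" "z\<^sub>0 ^ j *s l = inverse z\<^sub>0 *s (z\<^sub>0 ^ Suc j *s l)"
    using z0 by simp_all
  have "?f \<longlonglongrightarrow> z\<^sub>0 ^ Suc j *s l \<longleftrightarrow> (\<lambda>k. ?f (Suc k)) \<longlonglongrightarrow> z\<^sub>0 ^ Suc j *s l"
    by (rule filterlim_sequentially_Suc[symmetric])
  also have "\<dots> \<longleftrightarrow> ?g \<longlonglongrightarrow> z\<^sub>0 ^ j *s l"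
  proof
    assume "(\<lambda>k. ?f (Suc k)) \<longlonglongrightarrow> z\<^sub>0 ^ Suc j *s l"
    then have "(\<lambda>k. inverse (?q k) *s ?f (Suc k)) \<longlonglongrightarrow> inverse z\<^sub>0 *s (z\<^sub>0 ^ Suc j *s l)"
      by (rule tendsto_scale_vec[OF tendsto_inverse[OF pole_weight_ratio[OF z0] z0]])
    then show "?g \<longlonglongrightarrow> z\<^sub>0 ^ j *s l" unfolding gf[symmetric] z(2)[symmetric] .
  next
    assume "?g \<longlonglongrightarrow> z\<^sub>0 ^ j *s l"
    then have "(\<lambda>k. ?q k *s ?g k) \<longlonglongrightarrow> z\<^sub>0 *s (z\<^sub>0 ^ j *s l)"
      by (rule tendsto_scale_vec[OF pole_weight_ratio[OF z0]])
    then show "(\<lambda>k. ?f (Suc k)) \<longlonglongrightarrow> z\<^sub>0 ^ Suc j *s l" unfolding fg z(1) .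
  qed
  finally show ?thesis .
qed

lemma iterate_limit_all_components:
  assumes z0: "z\<^sub>0 \<noteq> 0" and i: "i \<ge> 1" and j: "j \<ge> 1"
    and lim: "(\<lambda>k. pole_weight z\<^sub>0 e k *s (companion_op a ^^ k) u i) \<longlonglongrightarrow> z\<^sub>0 ^ i *s l"
  shows "(\<lambda>k. pole_weight z\<^sub>0 e k *s (companion_op a ^^ k) u j) \<longlonglongrightarrow> z\<^sub>0 ^ j *s l"
proof -
  have eq: "((\<lambda>k. pole_weight z\<^sub>0 e k *s (companion_op a ^^ k) u j) \<longlonglongrightarrow> z\<^sub>0 ^ j *s l) \<longleftrightarrow>
     ((\<lambda>k. pole_weight z\<^sub>0 e k *s (companion_op a ^^ k) u 1) \<longlonglongrightarrow> z\<^sub>0 ^ 1 *s l)" if "1 \<le> j" for j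
    using that by (induction j rule: dec_induct) (auto simp: iterate_limit_shift[OF z0] simp del: power_Suc)
  show ?thesis using lim unfolding eq[OF i] eq[OF j] .
qed

section \<open>Uniformity\<close>

lemma uniform_limit_nullI:
  fixes f :: "nat \<Rightarrow> 'a \<Rightarrow> real"
  assumes "\<forall>\<^sub>F k in sequentially. \<forall>x\<in>S. \<bar>f k x\<bar> \<le> g k" "g \<longlonglongrightarrow> 0"
  shows "uniform_limit S f (\<lambda>_. 0) sequentially"
proof (rule uniform_limitI)
  fix \<epsilon> :: real assume "\<epsilon> > 0"
  then have "\<forall>\<^sub>F k in sequentially. g k < \<epsilon>" by (rule order_tendstoD(2)[OF assms(2)])
  with assms(1) show "\<forall>\<^sub>F k in sequentially. \<forall>x\<in>S. dist (f k x) 0 < \<epsilon>"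
    by eventually_elim (auto simp: dist_norm intro: le_less_trans)
qed

text \<open>Here \<open>s\<close> stands for the weights and \<open>T u\<close> for the limit of the weighted iterates of \<open>u\<close>.\<close>

context
  fixes a :: "nat \<Rightarrow> complex ^ 'n ^ 'n" and s :: "nat \<Rightarrow> complex" and z\<^sub>0 :: complex
    and T :: "'n cseq \<Rightarrow> 'n cseq"
  assumes s: "\<And>k. s k \<noteq> 0" "\<And>k. sgn (s k) = sgn z\<^sub>0 ^ k"
    and ratio: "(\<lambda>k. s (Suc k) / s k) \<longlonglongrightarrow> z\<^sub>0" and z0: "z\<^sub>0 \<noteq> 0"
    and T: "seq_linear T"
    and lim: "\<And>u j. u \<in> compactly_supported \<Longrightarrow> j \<ge> 1 \<Longrightarrow>
      (\<lambda>k. s k *s (companion_op a ^^ k) u j) \<longlonglongrightarrow> T u j"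
begin

lemma scaled_iterates_uniform_bound:
  "\<exists>\<epsilon>. \<epsilon> \<longlonglongrightarrow> 0 \<and> (\<forall>k. \<forall>u\<in>supported_upto K.
     restr_norm K\<^sub>0 (seq_scale (s k) ((companion_op a ^^ k) u) - T u) \<le> \<epsilon> k * restr_norm K u)"
proof -
  define D where "D k u = seq_scale (s k) ((companion_op a ^^ k) u) - T u" for k u
  define \<epsilon> where "\<epsilon> k = (\<Sum>p\<in>{1..K} \<times> UNIV. restr_norm K\<^sub>0 (D k (unit_seq p)))" for k
  have D: "seq_linear (D k)" for k
    unfolding D_def by (intro seq_linear_diff_comp seq_linear_scale_comp seq_linear_companion_op_power T)
  have "\<epsilon> \<longlonglongrightarrow> 0"
    unfolding \<epsilon>_def
  proof (intro tendsto_null_sum restr_norm_tendsto_0)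
    fix p :: "nat \<times> 'n" and j assume "p \<in> {1..K} \<times> UNIV" "j \<in> {1..K\<^sub>0}"
    then have "(\<lambda>k. s k *s (companion_op a ^^ k) (unit_seq p) j - T (unit_seq p) j) \<longlonglongrightarrow>
        T (unit_seq p) j - T (unit_seq p) j"
      by (intro tendsto_diff tendsto_const lim supported_upto_compactly[OF unit_seq_supported_upto]) auto
    then show "(\<lambda>k. D k (unit_seq p) j) \<longlonglongrightarrow> 0"
      by (simp add: D_def seq_scale_def)
  qed
  then show ?thesis
    using seq_linear_bound[OF D] unfolding \<epsilon>_def D_def by blast
qed

text \<open>On the ball of radius \<open>\<delta>\<close> around \<open>u\<close>, the norm of \<open>T v\<close> stays above half of its value at \<open>u\<close>
  and the norm of \<open>v\<close> is bounded by \<open>R\<close>. The scaled iterates then differ from \<open>T v\<close> by at most \<open>\<epsilon>\<^sub>k R\<close>.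
  For the eigenvalue equation, \<open>A x - z\<^sub>0\<^sup>-\<^sup>1 x\<close> with \<open>x = A\<^sup>k v\<close> is up to scaling the difference of
  two consecutive scaled iterates, each of them close to \<open>T v\<close>. That bound holds for large \<open>k\<close> only,
  once the restriction of the iterate is bounded away from \<open>0\<close>.\<close>

lemma power_iteration_locally_uniform_bounds:
  assumes u: "u \<in> supported_upto K" and pos: "restr_norm K\<^sub>0 (T u) > 0"
  shows "\<exists>\<delta>>0. \<exists>g h. g \<longlonglongrightarrow> 0 \<and> h \<longlonglongrightarrow> 0 \<and>
    (\<forall>k. \<forall>v\<in>supported_upto K. restr_norm K (v - u) < \<delta> \<longrightarrow>
       restr_norm K\<^sub>0 (seq_scale (sgn z\<^sub>0 ^ k) (normalized K\<^sub>0 ((companion_op a ^^ k) v)) - normalized K\<^sub>0 (T v)) \<le> g k) \<and>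
    (\<forall>\<^sub>F k in sequentially. \<forall>v\<in>supported_upto K. restr_norm K (v - u) < \<delta> \<longrightarrow>
       restr_norm K\<^sub>0 (companion_op a (normalized K\<^sub>0 ((companion_op a ^^ k) v))
                - seq_scale (inverse z\<^sub>0) (normalized K\<^sub>0 ((companion_op a ^^ k) v))) \<le> h k)"
proof -
  let ?A = "companion_op a"
  define S where "S k v = seq_scale (s k) ((?A ^^ k) v)" for k v
  obtain \<epsilon> where \<epsilon>: "\<epsilon> \<longlonglongrightarrow> 0"
      "\<And>k v. v \<in> supported_upto K \<Longrightarrow> restr_norm K\<^sub>0 (S k v - T v) \<le> \<epsilon> k * restr_norm K v"
    using scaled_iterates_uniform_bound[of K K\<^sub>0] unfolding S_def by blast
  define C where "C = (\<Sum>p\<in>{1..K} \<times> UNIV. restr_norm K\<^sub>0 (T (unit_seq p)))"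
  have C: "restr_norm K\<^sub>0 (T v) \<le> C * restr_norm K v" if "v \<in> supported_upto K" for v
    unfolding C_def by (rule seq_linear_bound[OF T that])
  have "C \<ge> 0" unfolding C_def by (intro sum_nonneg restr_norm_nonneg)
  define c where "c = restr_norm K\<^sub>0 (T u)"
  define \<delta> where "\<delta> = c / 2 / (C + 1)"
  have "\<delta> > 0" using pos \<open>C \<ge> 0\<close> by (simp add: \<delta>_def c_def)
  have "C * \<delta> \<le> c / 2"
  proof -
    have "C * \<delta> \<le> (C + 1) * \<delta>" using \<open>\<delta> > 0\<close> by simp
    also have "\<dots> = c / 2"
    proof -
      have "x * (c / 2 / x) = c / 2" if "x \<noteq> 0" for x using that by simp
      then show ?thesis using \<open>C \<ge> 0\<close> unfolding \<delta>_def by (metis add_nonneg_eq_0_iff zero_le_one zero_neq_one)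
    qed
    finally show ?thesis .
  qed
  define R where "R = restr_norm K u + \<delta>"
  have R: "restr_norm K v \<le> R" if "restr_norm K (v - u) < \<delta>" for v
    using restr_norm_triangle_sub[of K v u] that by (simp add: R_def)
  have lower: "c / 2 \<le> restr_norm K\<^sub>0 (T v)" if v: "v \<in> supported_upto K" "restr_norm K (v - u) < \<delta>" for v
  proof -
    have "restr_norm K\<^sub>0 (T v - T u) = restr_norm K\<^sub>0 (T (v - u))"
      using seq_linear_diff[OF T] v(1) u supported_upto_compactly by metis
    also have "\<dots> \<le> C * restr_norm K (v - u)"
      by (rule C[OF cseq.subspace_diff[OF subspace_supported_upto v(1) u]])
    also have "\<dots> \<le> C * \<delta>" using v(2) \<open>C \<ge> 0\<close> by (intro mult_left_mono) auto
    finally show ?thesis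
      using restr_norm_triangle_sub[of K\<^sub>0 "T u" "T v"] restr_norm_minus_commute[of K\<^sub>0 "T u" "T v"]
        \<open>C * \<delta> \<le> c / 2\<close> by (simp add: c_def)
  qed
  have "c > 0" using pos by (simp add: c_def)
  have \<epsilon>R: "restr_norm K\<^sub>0 (S k v - T v) \<le> \<bar>\<epsilon> k\<bar> * R"
    if v: "v \<in> supported_upto K" "restr_norm K (v - u) < \<delta>" for k v
  proof -
    have "restr_norm K\<^sub>0 (S k v - T v) \<le> \<bar>\<epsilon> k\<bar> * restr_norm K v"
      using \<epsilon>(2)[OF v(1), of k] restr_norm_nonneg[of K v]
      by (meson abs_ge_self mult_right_mono order_trans)
    also have "\<dots> \<le> \<bar>\<epsilon> k\<bar> * R" using R[OF v(2)] by (intro mult_left_mono) auto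
    finally show ?thesis .
  qed
  define g where "g k = 4 * (\<bar>\<epsilon> k\<bar> * R) / c" for k
  define \<beta> where "\<beta> k = s k / s (Suc k)" for k
  have \<beta>: "\<beta> \<longlonglongrightarrow> inverse z\<^sub>0"
    using tendsto_inverse[OF ratio z0] by (simp add: \<beta>_def[abs_def])
  define \<eta> where "\<eta> k = norm (\<beta> k) * (\<bar>\<epsilon> (Suc k)\<bar> * R) + norm (\<beta> k - inverse z\<^sub>0) * (C * R)
      + norm (inverse z\<^sub>0) * (\<bar>\<epsilon> k\<bar> * R)" for k
  have "\<epsilon> \<longlonglongrightarrow> 0" by fact
  then have \<epsilon>abs: "(\<lambda>k. \<bar>\<epsilon> k\<bar>) \<longlonglongrightarrow> 0" "(\<lambda>k. \<bar>\<epsilon> (Suc k)\<bar>) \<longlonglongrightarrow> 0"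
    using filterlim_sequentially_Suc[of "\<lambda>k. \<bar>\<epsilon> k\<bar>"] by (simp_all add: tendsto_rabs_zero)
  have "(\<lambda>k. \<eta> k) \<longlonglongrightarrow> norm (inverse z\<^sub>0) * (0 * R) + norm (inverse z\<^sub>0 - inverse z\<^sub>0) * (C * R)
      + norm (inverse z\<^sub>0) * (0 * R)"
    unfolding \<eta>_def by (intro tendsto_intros \<beta> \<epsilon>abs)
  then have \<eta>0: "\<eta> \<longlonglongrightarrow> 0" by simp
  have g0: "g \<longlonglongrightarrow> 0"
    using tendsto_mult[OF tendsto_const[of "4 * R / c"] \<epsilon>abs(1)] by (simp add: g_def[abs_def] mult_ac)
  have h0: "(\<lambda>k. \<eta> k / (c / 4)) \<longlonglongrightarrow> 0"
    using tendsto_divide[OF \<eta>0 tendsto_const, of "c / 4"] \<open>c > 0\<close> by simp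
  have first: "restr_norm K\<^sub>0 (seq_scale (sgn z\<^sub>0 ^ k) (normalized K\<^sub>0 ((?A ^^ k) v)) - normalized K\<^sub>0 (T v)) \<le> g k"
    if v: "v \<in> supported_upto K" "restr_norm K (v - u) < \<delta>" for k v
  proof -
    have Tv: "restr_norm K\<^sub>0 (T v) \<ge> c / 2" by (rule lower[OF v])
    have "seq_scale (sgn z\<^sub>0 ^ k) (normalized K\<^sub>0 ((?A ^^ k) v)) = normalized K\<^sub>0 (S k v)"
      using s by (simp add: S_def normalized_scale)
    then have "restr_norm K\<^sub>0 (seq_scale (sgn z\<^sub>0 ^ k) (normalized K\<^sub>0 ((?A ^^ k) v)) - normalized K\<^sub>0 (T v))
        \<le> 2 * restr_norm K\<^sub>0 (S k v - T v) / restr_norm K\<^sub>0 (T v)"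
      using restr_norm_normalized_diff[of K\<^sub>0 "T v" "S k v"] Tv \<open>c > 0\<close> by simp
    also have "\<dots> \<le> 2 * (\<bar>\<epsilon> k\<bar> * R) / (c / 2)"
      using \<epsilon>R[OF v, of k] Tv \<open>c > 0\<close> restr_norm_nonneg[of K\<^sub>0 "S k v - T v"] by (intro frac_le) auto
    finally show ?thesis by (simp add: g_def)
  qed
  have "(\<lambda>k. \<bar>\<epsilon> k\<bar> * R) \<longlonglongrightarrow> 0" using tendsto_mult_left_zero[OF \<epsilon>abs(1)] .
  then have "\<forall>\<^sub>F k in sequentially. \<bar>\<epsilon> k\<bar> * R < c / 4"
    using \<open>c > 0\<close> by (intro order_tendstoD(2)) auto
  then have second: "\<forall>\<^sub>F k in sequentially. \<forall>v\<in>supported_upto K. restr_norm K (v - u) < \<delta> \<longrightarrow>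
       restr_norm K\<^sub>0 (?A (normalized K\<^sub>0 ((?A ^^ k) v)) - seq_scale (inverse z\<^sub>0) (normalized K\<^sub>0 ((?A ^^ k) v)))
         \<le> \<eta> k / (c / 4)"
  proof eventually_elim
    case (elim k)
    show ?case
    proof (intro ballI impI)
      fix v assume v: "v \<in> supported_upto K" "restr_norm K (v - u) < \<delta>"
      have Sv: "c / 4 \<le> restr_norm K\<^sub>0 (S k v)"
        using lower[OF v] \<epsilon>R[OF v, of k] elim restr_norm_triangle_sub[of K\<^sub>0 "T v" "S k v"]
          restr_norm_minus_commute[of K\<^sub>0 "T v" "S k v"] by linarith
      define x where "x = (?A ^^ k) v"
      have x: "x \<in> compactly_supported"
        unfolding x_def by (rule companion_op_power_compactly_supported[OF supported_upto_compactly[OF v(1)]])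
      have Sx: "S k v = seq_scale (s k) x" "S (Suc k) v = seq_scale (s (Suc k)) (?A x)"
        by (simp_all add: S_def x_def)
      define Y where "Y = seq_scale (\<beta> k) (S (Suc k) v) - seq_scale (inverse z\<^sub>0) (S k v)"
      have "?A (normalized K\<^sub>0 x) = seq_scale (of_real (inverse (restr_norm K\<^sub>0 x))) (?A x)"
        using seq_linear_companion_op[of a] x unfolding seq_linear_def normalized_def by blast
      then have "?A (normalized K\<^sub>0 x) - seq_scale (inverse z\<^sub>0) (normalized K\<^sub>0 x) =
          seq_scale (of_real (inverse (restr_norm K\<^sub>0 x))) (?A x - seq_scale (inverse z\<^sub>0) x)"
        by (simp add: normalized_def cseq.scale_right_diff_distrib mult.commute)
      also have "?A x - seq_scale (inverse z\<^sub>0) x =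
          seq_scale (inverse (s k)) (seq_scale (\<beta> k) (S (Suc k) v) - seq_scale (inverse z\<^sub>0) (S k v))"
        using s(1) by (simp add: Sx \<beta>_def cseq.scale_right_diff_distrib)
      finally have eq: "?A (normalized K\<^sub>0 x) - seq_scale (inverse z\<^sub>0) (normalized K\<^sub>0 x) =
          seq_scale (of_real (inverse (restr_norm K\<^sub>0 x))) (seq_scale (inverse (s k)) Y)"
        unfolding Y_def .
      have "norm (complex_of_real (inverse (restr_norm K\<^sub>0 x))) = inverse (restr_norm K\<^sub>0 x)"
        using restr_norm_nonneg[of K\<^sub>0 x] by (simp add: norm_inverse)
      moreover have "restr_norm K\<^sub>0 (S k v) = norm (s k) * restr_norm K\<^sub>0 x"
        by (simp only: Sx(1) restr_norm_scale)
      ultimately have "restr_norm K\<^sub>0 (?A (normalized K\<^sub>0 x) - seq_scale (inverse z\<^sub>0) (normalized K\<^sub>0 x)) =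
          restr_norm K\<^sub>0 Y / restr_norm K\<^sub>0 (S k v)"
        unfolding eq restr_norm_scale by (simp only: norm_inverse) (simp add: divide_inverse)
      also have "\<dots> \<le> \<eta> k / (c / 4)"
      proof (intro frac_le Sv)
        \<comment> \<open>compare both iterates with the limit \<open>T v\<close>, on which the two coefficients nearly cancel\<close>
        have "Y = (seq_scale (\<beta> k) (S (Suc k) v - T v) + seq_scale (\<beta> k - inverse z\<^sub>0) (T v))
              - seq_scale (inverse z\<^sub>0) (S k v - T v)"
          by (simp add: Y_def cseq.scale_right_diff_distrib cseq.scale_left_diff_distrib)
        then have "restr_norm K\<^sub>0 Y \<le>
            restr_norm K\<^sub>0 (seq_scale (\<beta> k) (S (Suc k) v - T v)) +
            restr_norm K\<^sub>0 (seq_scale (\<beta> k - inverse z\<^sub>0) (T v)) +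
            restr_norm K\<^sub>0 (seq_scale (inverse z\<^sub>0) (S k v - T v))"
          using restr_norm_triangle_diff restr_norm_triangle by (smt (verit))
        also have "\<dots> \<le> \<eta> k"
          unfolding restr_norm_scale \<eta>_def
          using C[OF v(1)] mult_left_mono[OF R[OF v(2)] \<open>C \<ge> 0\<close>]
          by (intro add_mono mult_left_mono \<epsilon>R[OF v]) auto
        finally show "restr_norm K\<^sub>0 Y \<le> \<eta> k" .
        then show "0 \<le> \<eta> k" using restr_norm_nonneg order_trans by blast
      qed (use \<open>c > 0\<close> in auto)
      finally show "restr_norm K\<^sub>0 (?A (normalized K\<^sub>0 ((?A ^^ k) v)) -
          seq_scale (inverse z\<^sub>0) (normalized K\<^sub>0 ((?A ^^ k) v))) \<le> \<eta> k / (c / 4)"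
        by (simp add: x_def)
    qed
  qed
  show ?thesis
    using \<open>\<delta> > 0\<close> g0 h0 first second by blast
qed

lemma power_iteration_locally_uniform:
  assumes X: "X \<subseteq> supported_upto K" and pos: "\<And>u. u \<in> X \<Longrightarrow> restr_norm K\<^sub>0 (T u) > 0"
  shows "locally_uniformly_null K X (\<lambda>k u. restr_norm K\<^sub>0
       (seq_scale (sgn z\<^sub>0 ^ k) (normalized K\<^sub>0 ((companion_op a ^^ k) u)) - normalized K\<^sub>0 (T u)))" (is ?A)
    and "locally_uniformly_null K X (\<lambda>k u. restr_norm K\<^sub>0
       (companion_op a (normalized K\<^sub>0 ((companion_op a ^^ k) u))
                - seq_scale (inverse z\<^sub>0) (normalized K\<^sub>0 ((companion_op a ^^ k) u))))" (is ?B)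
proof -
  have bounds: "\<exists>\<delta>>0. \<exists>g h. g \<longlonglongrightarrow> 0 \<and> h \<longlonglongrightarrow> 0 \<and>
    (\<forall>k. \<forall>v\<in>supported_upto K. restr_norm K (v - u) < \<delta> \<longrightarrow>
       restr_norm K\<^sub>0 (seq_scale (sgn z\<^sub>0 ^ k) (normalized K\<^sub>0 ((companion_op a ^^ k) v)) - normalized K\<^sub>0 (T v)) \<le> g k) \<and>
    (\<forall>\<^sub>F k in sequentially. \<forall>v\<in>supported_upto K. restr_norm K (v - u) < \<delta> \<longrightarrow>
       restr_norm K\<^sub>0 (companion_op a (normalized K\<^sub>0 ((companion_op a ^^ k) v))
                - seq_scale (inverse z\<^sub>0) (normalized K\<^sub>0 ((companion_op a ^^ k) v))) \<le> h k)"
    if "u \<in> X" for u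
    using X pos[OF that] that by (intro power_iteration_locally_uniform_bounds) auto
  show ?A
    unfolding locally_uniformly_null_def
  proof
    fix u assume "u \<in> X"
    from bounds[OF this] obtain \<delta> g where "\<delta> > 0" "g \<longlonglongrightarrow> 0" and
      b: "\<And>k v. v \<in> supported_upto K \<Longrightarrow> restr_norm K (v - u) < \<delta> \<Longrightarrow>
       restr_norm K\<^sub>0 (seq_scale (sgn z\<^sub>0 ^ k) (normalized K\<^sub>0 ((companion_op a ^^ k) v)) - normalized K\<^sub>0 (T v)) \<le> g k"
      by blast
    show "\<exists>\<delta>>0. uniform_limit {u' \<in> X. restr_norm K (u' - u) < \<delta>} (\<lambda>k u. restr_norm K\<^sub>0
       (seq_scale (sgn z\<^sub>0 ^ k) (normalized K\<^sub>0 ((companion_op a ^^ k) u)) - normalized K\<^sub>0 (T u)))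
       (\<lambda>_. 0) sequentially"
      by (intro exI[of _ \<delta>] conjI uniform_limit_nullI[OF _ \<open>g \<longlonglongrightarrow> 0\<close>] always_eventually allI)
         (use \<open>\<delta> > 0\<close> X b in \<open>auto simp: abs_of_nonneg[OF restr_norm_nonneg]\<close>)
  qed
  show ?B
    unfolding locally_uniformly_null_def
  proof
    fix u assume "u \<in> X"
    from bounds[OF this] obtain \<delta> h where "\<delta> > 0" "h \<longlonglongrightarrow> 0" and
      b: "\<forall>\<^sub>F k in sequentially. \<forall>v\<in>supported_upto K. restr_norm K (v - u) < \<delta> \<longrightarrow>
       restr_norm K\<^sub>0 (companion_op a (normalized K\<^sub>0 ((companion_op a ^^ k) v))
                - seq_scale (inverse z\<^sub>0) (normalized K\<^sub>0 ((companion_op a ^^ k) v))) \<le> h k"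
      by blast
    show "\<exists>\<delta>>0. uniform_limit {u' \<in> X. restr_norm K (u' - u) < \<delta>} (\<lambda>k u. restr_norm K\<^sub>0
       (companion_op a (normalized K\<^sub>0 ((companion_op a ^^ k) u))
                - seq_scale (inverse z\<^sub>0) (normalized K\<^sub>0 ((companion_op a ^^ k) u)))) (\<lambda>_. 0) sequentially"
    proof (intro exI[of _ \<delta>] conjI uniform_limit_nullI[OF _ \<open>h \<longlonglongrightarrow> 0\<close>] \<open>\<delta> > 0\<close>)
      show "\<forall>\<^sub>F k in sequentially. \<forall>x\<in>{u' \<in> X. restr_norm K (u' - u) < \<delta>}.
        \<bar>restr_norm K\<^sub>0 (companion_op a (normalized K\<^sub>0 ((companion_op a ^^ k) x))
                - seq_scale (inverse z\<^sub>0) (normalized K\<^sub>0 ((companion_op a ^^ k) x)))\<bar> \<le> h k"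
        using b by eventually_elim (use X in \<open>auto simp: abs_of_nonneg[OF restr_norm_nonneg]\<close>)
    qed
  qed
qed

end

section \<open>Convergence of the power iteration\<close>

theorem proposition3p3:
  fixes \<iota> :: "complex \<Rightarrow> complex ^ 'n ^ 'n"
    and a :: "nat \<Rightarrow> complex ^ 'n ^ 'n"
    and z\<^sub>0 :: complex and M :: real
  assumes power_series:
      "\<exists>r>0. \<forall>z\<in>ball 0 r. \<forall>i j. (\<lambda>k. a k $ i $ j * z ^ k) sums (\<iota> z $ i $ j)"
    and invertible_0: "invertible (a 0)"
    and meromorphic: "\<forall>i j. (\<lambda>z. \<iota> z $ i $ j) meromorphic_on ball 0 M"
    and spectral: "spectral_value \<iota> z\<^sub>0" "norm z\<^sub>0 < M"
    and unique: "\<forall>z. norm z < M \<and> z \<noteq> z\<^sub>0 \<longrightarrow> \<not> spectral_value \<iota> z"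
  shows "\<exists>E. cseq.subspace E \<and> E \<subseteq> compactly_supported \<and> finite_codim E compactly_supported \<and>
    (\<forall>K\<ge>1. \<not> supported_upto K \<subseteq> E \<and>
      (\<exists>ustar.
        (\<forall>u \<in> supported_upto K - E. formal_eigenvector \<iota> z\<^sub>0 (ustar u)) \<and>
        (\<forall>K\<^sub>0\<ge>1.
          locally_uniformly_null K (supported_upto K - E)
            (\<lambda>k u. restr_norm K\<^sub>0
               (seq_scale (sgn z\<^sub>0 ^ k) (normalized K\<^sub>0 ((companion_op a ^^ k) u))
                - normalized K\<^sub>0 (ustar u))) \<and>
          locally_uniformly_null K (supported_upto K - E)
            (\<lambda>k u. restr_norm K\<^sub>0
               (companion_op a (normalized K\<^sub>0 ((companion_op a ^^ k) u))
                - seq_scale (inverse z\<^sub>0) (normalized K\<^sub>0 ((companion_op a ^^ k) u)))))))"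
proof -
  obtain r where r: "r > 0"
    and ser: "\<And>z i j. z \<in> ball 0 r \<Longrightarrow> (\<lambda>k. a k $ i $ j * z ^ k) sums (\<iota> z $ i $ j)"
    using power_series by blast
  have z0: "z\<^sub>0 \<noteq> 0" by (rule spectral_value_nonzero[OF r ser invertible_0 spectral(1)])
  obtain e \<Phi> where hol: "\<And>i j. (\<lambda>w. \<Phi> w $ i $ j) holomorphic_on ball 0 M"
    and \<Phi>z: "\<Phi> z\<^sub>0 \<noteq> (0 :: complex ^ 'n ^ 'n)"
    and prod: "\<And>z. z \<in> ball 0 M \<Longrightarrow> \<forall>\<^sub>F w in at z. invertible (\<iota> w) \<and>
       \<Phi> w ** \<iota> w = mat ((w - z\<^sub>0) ^ Suc e) \<and> \<iota> w ** \<Phi> w = mat ((w - z\<^sub>0) ^ Suc e)"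
    using resolvent_times_power_holomorphic[OF meromorphic[rule_format] spectral
        unique[rule_format, OF conjI]]
    by blast
  have "0 < M" using spectral(2) by (metis norm_ge_zero le_less_trans)
  define A where "A = companion_op a"
  define s where "s = pole_weight z\<^sub>0 e"
  define \<kappa> where "\<kappa> = inverse ((- z\<^sub>0) ^ Suc e)"
  have "\<kappa> \<noteq> 0" using z0 by (simp add: \<kappa>_def)
  have prod0: "\<forall>\<^sub>F w in at 0. \<Phi> w ** \<iota> w = mat ((w - z\<^sub>0) ^ Suc e)"
    using prod[of 0] \<open>0 < M\<close> by (auto elim: eventually_mono)
  have prodz: "\<forall>\<^sub>F w in at z\<^sub>0. \<iota> w ** \<Phi> w = mat ((w - z\<^sub>0) ^ Suc e)"
    using prod[of z\<^sub>0] spectral(2) by (auto elim: eventually_mono)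
  have lim: "(\<lambda>m. s m *s (A ^^ m) u K) \<longlonglongrightarrow> \<kappa> *s (\<Phi> z\<^sub>0 *v start_poly a u K z\<^sub>0)"
    if "u \<in> supported_upto K" "K \<ge> 1" for u K
    unfolding s_def A_def \<kappa>_def
    by (rule iterate_component_limit[OF r ser invertible_0 hol z0 spectral(2) prod0 that])
  have "\<forall>u\<in>compactly_supported. \<exists>l. in_kernel_at \<iota> z\<^sub>0 l \<and>
      (\<forall>j\<ge>1. (\<lambda>k. s k *s (A ^^ k) u j) \<longlonglongrightarrow> z\<^sub>0 ^ j *s l)"
  proof
    fix u :: "'n cseq" assume "u \<in> compactly_supported"
    then obtain K where K: "K \<ge> 1" "u \<in> supported_upto K" unfolding compactly_supported_iff by blast
    \<comment> \<open>the limit for component \<open>K\<close> is \<open>z\<^sub>0\<^sup>K l\<close>, which leads to the same \<open>l\<close> for all components\<close>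
    define l where "l = (inverse z\<^sub>0 ^ K * \<kappa>) *s (\<Phi> z\<^sub>0 *v start_poly a u K z\<^sub>0)"
    have "z\<^sub>0 ^ K * (inverse z\<^sub>0 ^ K * \<kappa>) = \<kappa>"
      using z0 by (simp add: power_inverse)
    then have "\<kappa> *s (\<Phi> z\<^sub>0 *v start_poly a u K z\<^sub>0) = z\<^sub>0 ^ K *s l"
      unfolding l_def vector_smult_assoc by simp
    then have "(\<lambda>k. s k *s (A ^^ k) u K) \<longlonglongrightarrow> z\<^sub>0 ^ K *s l" using lim[OF K(2,1)] by simp
    then have "(\<lambda>k. s k *s (A ^^ k) u j) \<longlonglongrightarrow> z\<^sub>0 ^ j *s l" if "j \<ge> 1" for j
      using iterate_limit_all_components[OF z0 K(1) that] unfolding s_def A_def by blast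
    moreover have "root_vector \<iota> z\<^sub>0 (\<Phi> z\<^sub>0 *v start_poly a u K z\<^sub>0)"
    proof (rule root_vector_of_resolvent[OF prodz])
      show "(\<lambda>w. \<Phi> w $ i $ j) analytic_on {z\<^sub>0}" for i j
        using hol spectral(2) by (intro holomorphic_on_imp_analytic_at[of _ "ball 0 M"]) auto
      show "(\<lambda>w. start_poly a u K w $ i) analytic_on {z\<^sub>0}" for i
        by (intro holomorphic_on_imp_analytic_at[of _ UNIV] start_poly_holomorphic) auto
    qed
    then have "in_kernel_at \<iota> z\<^sub>0 l"
      unfolding l_def by (intro in_kernel_at_if_root_vector root_vector_scale)
    ultimately show "\<exists>l. in_kernel_at \<iota> z\<^sub>0 l \<and> (\<forall>j\<ge>1. (\<lambda>k. s k *s (A ^^ k) u j) \<longlonglongrightarrow> z\<^sub>0 ^ j *s l)"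
      by blast
  qed
  from bchoice[OF this] obtain L where kernel: "\<And>u. u \<in> compactly_supported \<Longrightarrow> in_kernel_at \<iota> z\<^sub>0 (L u)"
    and L: "\<And>u j. u \<in> compactly_supported \<Longrightarrow> j \<ge> 1 \<Longrightarrow> (\<lambda>k. s k *s (A ^^ k) u j) \<longlonglongrightarrow> z\<^sub>0 ^ j *s L u"
    by blast
  have L1: "(\<lambda>k. s k *s (A ^^ k) u 1) \<longlonglongrightarrow> z\<^sub>0 *s L u" if "u \<in> compactly_supported" for u
    using L[OF that, of 1] by simp
  have Lunique: "L u = l" if "u \<in> compactly_supported" "(\<lambda>k. s k *s (A ^^ k) u 1) \<longlonglongrightarrow> z\<^sub>0 *s l" for u l
    using LIMSEQ_unique[OF L1[OF that(1)] that(2)] z0 by simp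
  have A_linear: "seq_linear (A ^^ k)" for k unfolding A_def by (rule seq_linear_companion_op_power)
  have L_add: "L (u + v) = L u + L v" if uv: "u \<in> compactly_supported" "v \<in> compactly_supported" for u v
  proof (rule Lunique)
    have "s k *s (A ^^ k) (u + v) 1 = s k *s (A ^^ k) u 1 + s k *s (A ^^ k) v 1" for k
    proof -
      have "(A ^^ k) (u + v) = (A ^^ k) u + (A ^^ k) v"
        using A_linear[of k] uv unfolding seq_linear_def by blast
      then show ?thesis by (simp add: vector_add_ldistrib)
    qed
    then show "(\<lambda>k. s k *s (A ^^ k) (u + v) 1) \<longlonglongrightarrow> z\<^sub>0 *s (L u + L v)"
      using tendsto_add[OF L1[OF uv(1)] L1[OF uv(2)]] by (simp add: vector_add_ldistrib)
  qed (rule cseq.subspace_add[OF subspace_compactly_supported uv])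
  have L_scale: "L (seq_scale c u) = c *s L u" if u: "u \<in> compactly_supported" for c u
  proof (rule Lunique)
    have "s k *s (A ^^ k) (seq_scale c u) 1 = c *s (s k *s (A ^^ k) u 1)" for k
    proof -
      have "(A ^^ k) (seq_scale c u) = seq_scale c ((A ^^ k) u)"
        using A_linear[of k] u unfolding seq_linear_def by blast
      then show ?thesis by (simp add: seq_scale_def vector_smult_assoc mult.commute)
    qed
    then show "(\<lambda>k. s k *s (A ^^ k) (seq_scale c u) 1) \<longlonglongrightarrow> z\<^sub>0 *s (c *s L u)"
      using tendsto_scale_vec[OF tendsto_const L1[OF u], of c] by (simp add: vector_smult_assoc mult.commute)
  qed (rule cseq.subspace_scale[OF subspace_compactly_supported u])
  define T :: "'n cseq \<Rightarrow> 'n cseq" where "T u = (\<lambda>j. if j = 0 then 0 else z\<^sub>0 ^ j *s L u)" for u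
  have T: "seq_linear T"
  proof -
    have "T (u + v) = T u + T v" if "u \<in> compactly_supported" "v \<in> compactly_supported" for u v
      unfolding T_def L_add[OF that] by (auto simp: fun_eq_iff vector_add_ldistrib)
    moreover have "T (seq_scale c u) = seq_scale c (T u)" if "u \<in> compactly_supported" for c u
      unfolding T_def L_scale[OF that]
      by (auto simp: fun_eq_iff seq_scale_def vector_smult_assoc mult.commute)
    ultimately show ?thesis by (simp add: seq_linear_def)
  qed
  have limT: "(\<lambda>k. s k *s (companion_op a ^^ k) u j) \<longlonglongrightarrow> T u j" if "u \<in> compactly_supported" "j \<ge> 1" for u j
    using L[OF that] that by (simp add: T_def A_def)
  define E where "E = {u \<in> compactly_supported. L u = 0}"
  have "\<not> supported_upto K \<subseteq> E" if "K \<ge> 1" for K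
  proof -
    obtain y where y: "\<Phi> z\<^sub>0 *v y \<noteq> 0"
      using \<Phi>z matrix_eq[of "\<Phi> z\<^sub>0" 0] by auto
    \<comment> \<open>chosen so that the polynomial \<open>P\<close> of \<open>u\<close> is the constant \<open>y\<close>\<close>
    define u :: "'n cseq" where "u = (\<lambda>j. if j = 1 then matrix_inv (a 0) *v y else 0)"
    have u: "u \<in> supported_upto 1" by (simp add: u_def supported_upto_def)
    have "start_poly a u 1 z\<^sub>0 = y"
      unfolding start_poly_single using invertible_0
      by (simp add: u_def matrix_vector_mul_assoc matrix_inv_right)
    then have "z\<^sub>0 *s L u = \<kappa> *s (\<Phi> z\<^sub>0 *v y)"
      using LIMSEQ_unique[OF L1[OF supported_upto_compactly[OF u]] lim[OF u]] by simp
    then have "L u \<noteq> 0" using y \<open>\<kappa> \<noteq> 0\<close> by auto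
    then have "u \<notin> E" by (simp add: E_def)
    then show ?thesis using u supported_upto_mono[OF that] by blast
  qed
  moreover have "formal_eigenvector \<iota> z\<^sub>0 (T u)" if "u \<in> supported_upto K - E" for u K
    unfolding formal_eigenvector_def
    using that kernel[of u] supported_upto_compactly[of u K]
    by (intro exI[of _ "L u"]) (auto simp: E_def T_def)
  moreover have pos: "restr_norm K\<^sub>0 (T u) > 0" if "u \<in> supported_upto K - E" "K\<^sub>0 \<ge> 1" for u K K\<^sub>0
  proof -
    have "L u \<noteq> 0" using that supported_upto_compactly[of u K] by (auto simp: E_def)
    then have "0 < norm (T u 1)" using z0 by (simp add: T_def)
    also have "\<dots> \<le> restr_norm K\<^sub>0 (T u)" using that(2) by (intro norm_le_restr_norm) auto
    finally show ?thesis .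
  qed
  have "(\<lambda>k. s (Suc k) / s k) \<longlonglongrightarrow> z\<^sub>0" "\<And>k. s k \<noteq> 0" "\<And>k. sgn (s k) = sgn z\<^sub>0 ^ k"
    unfolding s_def using z0 by (simp_all add: pole_weight_ratio pole_weight_nonzero sgn_pole_weight)
  note uniform = power_iteration_locally_uniform[OF this(2,3,1) z0 T limT Diff_subset pos]
  moreover have "cseq.subspace E" "finite_codim E compactly_supported"
    unfolding E_def by (rule kernel_finite_codim[OF subspace_compactly_supported L_add L_scale]; assumption)+
  moreover have "E \<subseteq> compactly_supported" by (auto simp: E_def)
  ultimately show ?thesis by (intro exI[of _ E] conjI allI impI exI[of _ T] ballI) simp_all
qed

end
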